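(* Let $p\in[1,2]$, $a = 2^{\frac{2p-1}{2}}$, $b=2^{\frac{5-2p}{4}}p^{\frac{1-2p}{2}}$, let $R$ be a number with $\sqrt{2d(x^* )}\le R$, and for all $i\ge 0$ let $$\alpha_i = \frac{1}{a}\left(\frac{i+p}{p}\right)^{p-1},\quad \beta_i = L+\frac{b\sigma}{R}(i+p+1)^{\frac{2p-1}{2}},\quad B_i = a\alpha_i^2=\frac1a\left(\frac{i+p}{p}\right)^{2p-2}.$$ Then the sequence $y_k$ generated by the Stochastic Intermediate Gradient Method (SIGM, described in the context) with these sequences satisfies, for $k\ge 1$, $$\mathbb{E}_{\xi_0,\dots,\xi_k}\varphi(y_k)-\varphi^* \le \frac{LR^2p^p2^{\frac{2p-3}{2}}}{(k+p)^p}+\frac{\sigma R\,2^{\frac{3+2p}{4}}\sqrt{p}\,(k+p+2)^{p-\frac12}}{(k+p)^p}+2^{2p-1}\left(\left(\frac{k+p}{p}\right)^{p-1}+1\right)\delta$$ $$\le \frac{C_1LR^2}{k^p}+\frac{C_2\sigma R}{\sqrt{k}}+C_3k^{p-1}\delta=\Theta\left(\frac{LR^2}{k^p}+\frac{\sigma R}{\sqrt k}+k^{p-1}\delta\right),$$ where $C_1=4\sqrt2$, $C_2=16\sqrt2$, $C_3=48$.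
   Context: $E$ is a finite-dimensional real vector space with norm $\|\cdot\|$, $E^*$ its dual, $\langle g,x\rangle$ the value of $g\in E^*$ at $x\in E$, $\|g\|_*=\sup\{\langle g,y\rangle:\|y\|\le1\}$. The problem is $\min_{x\in Q}\{\varphi(x):=f(x)+h(x)\}$, with $Q\subset E$ closed convex, $h$ a simple convex function (the auxiliary minimization problems below are solvable), and $f$ convex. $x^*$ is a solution and $\varphi^*=\varphi(x^* )$. Stochastic inexact oracle: there are $L>0$, $\delta\ge0$, $\sigma\ge 0$ such that for every $x\in Q$ there exist $f_{\delta,L}(x)\in\mathbb{R}$, $g_{\delta,L}(x)\in E^*$ with $$0\le f(y)-f_{\delta,L}(x)-\langle g_{\delta,L}(x),y-x\rangle\le\frac L2\|x-y\|^2+\delta\quad\forall y\in Q.$$ The method uses stochastic approximations $F_{\delta,L}(x,\xi)$, $G_{\delta,L}(x,\xi)$, where $\xi$ is a random variable associated with $x$, such that $\mathbb{E}_\xi F_{\delta,L}(x,\xi)=f_{\delta,L}(x)$, $\mathbb{E}_\xi G_{\delta,L}(x,\xi)=g_{\delta,L}(x)$, $\mathbb{E}_\xi\|G_{\delta,L}(x,\xi)-g_{\delta,L}(x)\|_*^2\le\sigma^2$. At each query a fresh realization of $\xi$ is drawn. Prox-function: $d$ is differentiable and strongly convex with parameter $1$ on $Q$ w.r.t. $\|\cdot\|$; $x_0$ is its minimizer on $Q$, $d(x_0)=0$, and $d(x)\ge\frac12\|x-x_0\|^2$ on $Q$. Bregman distance: $V(x,z)=d(x)-d(z)-\langle\nabla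 d(z),x-z\rangle$. SIGM: given sequences $\{\alpha_i\},\{\beta_i\},\{B_i\}$, put $A_k=\sum_{i=0}^k\alpha_i$, $\tau_i=\alpha_{i+1}/B_{i+1}$. Compute $x_0=\arg\min_{x\in Q}d(x)$, draw $\xi_0$, and set $y_0=\arg\min_{x\in Q}\{\beta_0d(x)+\alpha_0\langle G_{\delta,L}(x_0,\xi_0),x-x_0\rangle+\alpha_0h(x)\}$. For $k=0,1,\dots$: 1. $z_k=\arg\min_{x\in Q}\{\beta_kd(x)+\sum_{i=0}^k\alpha_i\langle G_{\delta,L}(x_i,\xi_i),x-x_i\rangle+A_kh(x)\}$; 2. $x_{k+1}=\tau_kz_k+(1-\tau_k)y_k$; draw $\xi_{k+1}$ and compute $G_{\delta,L}(x_{k+1},\xi_{k+1})$; 3. $\hat x_{k+1}=\arg\min_{x\in Q}\{\beta_kV(x,z_k)+\alpha_{k+1}\langle G_{\delta,L}(x_{k+1},\xi_{k+1}),x-z_k\rangle+\alpha_{k+1}h(x)\}$; 4. $w_{k+1}=\tau_k\hat x_{k+1}+(1-\tau_k)y_k$; 5. $y_{k+1}=\frac{A_{k+1}-B_{k+1}}{A_{k+1}}y_k+\frac{B_{k+1}}{A_{k+1}}w_{k+1}$. *)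

theory Defs
  imports "HOL-Probability.Probability" "HOL-Library.Landau_Symbols"
begin

(* E is a type 'e of class real_normed_vector, so that the norm is arbitrary; finite dimension is
   an explicit hypothesis.  The dual space is 'e \<Rightarrow>\<^sub>L real, whose library norm (the operator norm)
   is the dual norm; in finite dimension every linear functional is bounded. *)

definition finite_dim :: "'e::real_vector itself \<Rightarrow> bool" where
  "finite_dim _ \<longleftrightarrow> (\<exists>b::'e set. finite b \<and> span b = UNIV)"

definition strongly_convex_on :: "real \<Rightarrow> 'e::real_normed_vector set \<Rightarrow> ('e \<Rightarrow> real) \<Rightarrow> bool" where
  "strongly_convex_on m Q d \<longleftrightarrow> convex Q \<and>
     (\<forall>u\<in>Q. \<forall>v\<in>Q. \<forall>t\<in>{0..1}.
        d (t *\<^sub>R u + (1 - t) *\<^sub>R v)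
          \<le> t * d u + (1 - t) * d v - m / 2 * t * (1 - t) * (norm (u - v))\<^sup>2)"

(* Differentiability is relative to Q.  If Q has empty interior, the gradient is not unique, but
   its values on differences of points of Q, hence the Bregman distance on Q, are. *)

definition prox_function ::
  "'e::real_normed_vector set \<Rightarrow> ('e \<Rightarrow> real) \<Rightarrow> ('e \<Rightarrow> 'e \<Rightarrow>\<^sub>L real) \<Rightarrow> 'e \<Rightarrow> bool" where
  "prox_function Q d grad_d x0 \<longleftrightarrow>
     (\<forall>u\<in>Q. (d has_derivative blinfun_apply (grad_d u)) (at u within Q)) \<and>
     strongly_convex_on 1 Q d \<and>
     is_arg_min d (\<lambda>u. u \<in> Q) x0 \<and> d x0 = 0 \<and>
     (\<forall>u\<in>Q. d u \<ge> 1 / 2 * (norm (u - x0))\<^sup>2)"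

definition bregman ::
  "('e::real_normed_vector \<Rightarrow> real) \<Rightarrow> ('e \<Rightarrow> 'e \<Rightarrow>\<^sub>L real) \<Rightarrow> 'e \<Rightarrow> 'e \<Rightarrow> real" where
  "bregman d grad_d u z = d u - d z - blinfun_apply (grad_d z) (u - z)"

definition inexact_oracle ::
  "'e::real_normed_vector set \<Rightarrow> ('e \<Rightarrow> real) \<Rightarrow> real \<Rightarrow> real
     \<Rightarrow> ('e \<Rightarrow> real) \<Rightarrow> ('e \<Rightarrow> 'e \<Rightarrow>\<^sub>L real) \<Rightarrow> bool" where
  "inexact_oracle Q f \<delta> L f\<^sub>o g\<^sub>o \<longleftrightarrow>
     (\<forall>u\<in>Q. \<forall>v\<in>Q.
        0 \<le> f v - f\<^sub>o u - blinfun_apply (g\<^sub>o u) (v - u) \<and>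
        f v - f\<^sub>o u - blinfun_apply (g\<^sub>o u) (v - u) \<le> L / 2 * (norm (u - v))\<^sup>2 + \<delta>)"

(* \<mu> u is the law of the random variable associated with the query point u; it takes values in the
   measurable space S.  The Bochner integral is not available at type 'e \<Rightarrow>\<^sub>L real (no second
   countability instance), so measurability and mean of G are expressed componentwise, i.e. after
   evaluation at every vector; in finite dimension this is the usual vector-valued notion. *)

definition stochastic_oracle ::
  "'e::real_normed_vector set \<Rightarrow> 's measure \<Rightarrow> ('e \<Rightarrow> 's measure) \<Rightarrow> real
     \<Rightarrow> ('e \<Rightarrow> real) \<Rightarrow> ('e \<Rightarrow> 'e \<Rightarrow>\<^sub>L real)
     \<Rightarrow> ('e \<Rightarrow> 's \<Rightarrow> real) \<Rightarrow> ('e \<Rightarrow> 's \<Rightarrow> 'e \<Rightarrow>\<^sub>L real) \<Rightarrow> bool" where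
  "stochastic_oracle Q S \<mu> \<sigma> f\<^sub>o g\<^sub>o F G \<longleftrightarrow>
     \<mu> \<in> restrict_space borel Q \<rightarrow>\<^sub>M prob_algebra S \<and>
     (\<forall>v. (\<lambda>(u, s). blinfun_apply (G u s) v) \<in> borel_measurable (restrict_space borel Q \<Otimes>\<^sub>M S)) \<and>
     (\<forall>u\<in>Q.
        integrable (\<mu> u) (F u) \<and> (\<integral>s. F u s \<partial>\<mu> u) = f\<^sub>o u \<and>
        (\<forall>v. integrable (\<mu> u) (\<lambda>s. blinfun_apply (G u s) v) \<and>
             (\<integral>s. blinfun_apply (G u s) v \<partial>\<mu> u) = blinfun_apply (g\<^sub>o u) v) \<and>
        integrable (\<mu> u) (\<lambda>s. (norm (G u s - g\<^sub>o u))\<^sup>2) \<and>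
        (\<integral>s. (norm (G u s - g\<^sub>o u))\<^sup>2 \<partial>\<mu> u) \<le> \<sigma>\<^sup>2)"

definition past :: "'w measure \<Rightarrow> 's measure \<Rightarrow> (nat \<Rightarrow> 'w \<Rightarrow> 's) \<Rightarrow> nat \<Rightarrow> 'w measure" where
  "past M S \<xi> i =
     vimage_algebra (space M) (\<lambda>\<omega>. \<lambda>j\<in>{..<i}. \<xi> j \<omega>) (\<Pi>\<^sub>M j\<in>{..<i}. S)"

(* Fresh draws: given \<xi> 0, ..., \<xi> (i - 1), the conditional law of \<xi> i is the law associated with
   the i-th query point.  If \<mu> is constant, this says that the \<xi> i are i.i.d. with law \<mu>. *)

definition fresh_draws ::
  "'w measure \<Rightarrow> 's measure \<Rightarrow> ('e \<Rightarrow> 's measure) \<Rightarrow> (nat \<Rightarrow> 'w \<Rightarrow> 'e) \<Rightarrow> (nat \<Rightarrow> 'w \<Rightarrow> 's) \<Rightarrow> bool" where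
  "fresh_draws M S \<mu> x \<xi> \<longleftrightarrow>
     (\<forall>i. \<xi> i \<in> M \<rightarrow>\<^sub>M S) \<and>
     (\<forall>i. \<forall>C\<in>sets S. AE \<omega> in M.
        real_cond_exp M (past M S \<xi> i) (\<lambda>\<omega>. indicator C (\<xi> i \<omega>)) \<omega> = measure (\<mu> (x i \<omega>)) C)"

(* One run of the method.  \<gamma> i is the stochastic gradient computed at the i-th query point. *)

definition SIGM ::
  "'e::real_normed_vector set \<Rightarrow> ('e \<Rightarrow> real) \<Rightarrow> ('e \<Rightarrow> real) \<Rightarrow> ('e \<Rightarrow> 'e \<Rightarrow>\<^sub>L real)
     \<Rightarrow> (nat \<Rightarrow> real) \<Rightarrow> (nat \<Rightarrow> real) \<Rightarrow> (nat \<Rightarrow> real) \<Rightarrow> (nat \<Rightarrow> 'e \<Rightarrow>\<^sub>L real)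
     \<Rightarrow> (nat \<Rightarrow> 'e) \<Rightarrow> (nat \<Rightarrow> 'e) \<Rightarrow> (nat \<Rightarrow> 'e) \<Rightarrow> (nat \<Rightarrow> 'e) \<Rightarrow> (nat \<Rightarrow> 'e) \<Rightarrow> bool" where
  "SIGM Q h d grad_d \<alpha> \<beta> B \<gamma> x y z xhat w \<longleftrightarrow>
     (let A = (\<lambda>k. \<Sum>i\<le>k. \<alpha> i); \<tau> = (\<lambda>k. \<alpha> (Suc k) / B (Suc k)) in
       is_arg_min d (\<lambda>u. u \<in> Q) (x 0) \<and>
       is_arg_min (\<lambda>u. \<beta> 0 * d u + \<alpha> 0 * blinfun_apply (\<gamma> 0) (u - x 0) + \<alpha> 0 * h u)
         (\<lambda>u. u \<in> Q) (y 0) \<and>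
       (\<forall>k.
         is_arg_min
           (\<lambda>u. \<beta> k * d u + (\<Sum>i\<le>k. \<alpha> i * blinfun_apply (\<gamma> i) (u - x i)) + A k * h u)
           (\<lambda>u. u \<in> Q) (z k) \<and>
         x (Suc k) = \<tau> k *\<^sub>R z k + (1 - \<tau> k) *\<^sub>R y k \<and>
         is_arg_min
           (\<lambda>u. \<beta> k * bregman d grad_d u (z k)
                + \<alpha> (Suc k) * blinfun_apply (\<gamma> (Suc k)) (u - z k) + \<alpha> (Suc k) * h u)
           (\<lambda>u. u \<in> Q) (xhat (Suc k)) \<and>
         w (Suc k) = \<tau> k *\<^sub>R xhat (Suc k) + (1 - \<tau> k) *\<^sub>R y k \<and>
         y (Suc k) = ((A (Suc k) - B (Suc k)) / A (Suc k)) *\<^sub>R y k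
                     + (B (Suc k) / A (Suc k)) *\<^sub>R w (Suc k)))"

end

theory Submission
  imports Defs
begin

text \<open>
  Let \<open>\<eta> i = G (x i) (\<xi> i) - g\<^sub>o (x i)\<close> be the noise. The estimate-sequence argument, in which \<open>z k\<close>
  minimises the model \<open>\<psi> k\<close>, is run with the exact values of \<open>f\<^sub>o\<close> in the model and the noise kept
  as an error term. Relative to a solution \<open>xs\<close> it gives, on every path,
  \<open>A k * (\<phi> (y k) - \<phi> xs) \<le> Y k\<close> with
  \<open>Y k = \<beta> k * d xs + (\<Sum>i\<le>k. B i * \<delta> + B i * (norm (\<eta> i))\<^sup>2 / (2 * (\<beta> i - L)) + \<eta> i (v i))\<close>,
  where \<open>v i\<close> depends on the past draws only. The left-hand side is nonnegative, hence so is \<open>Y k\<close>,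
  and this replaces any a priori integrability of the iterates: integrating \<open>Y k\<close> over the last draw
  with the past frozen kills \<open>\<eta> k (v k)\<close>, so by induction the expectation of \<open>Y k\<close> is at most the
  same sum with \<open>\<sigma>\<^sup>2\<close> for the squared noise and without the linear terms. The iterates are measurable
  in the past because the minimiser of a strongly convex function is Lipschitz in the linear part of
  the objective.
\<close>

text \<open>The surplus \<open>\<beta> i - L\<close> exists to absorb noise: by Young's inequality
  it pays for the product of noise and displacement, at the cost of the quotient in
  \<open>Y k\<close>. A larger surplus lowers that cost and raises \<open>\<beta> k * d xs\<close>;
  with the exponent (2p - 1)/2 both grow like k to the power p - 1/2, and \<open>b\<close> sets
  their ratio. The constant \<open>a\<close> bounds the growth of \<open>\<beta>\<close> in one
  step: the model offers a Bregman term of weight \<open>\<beta> k\<close>, the oracle bound asks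
  for a quadratic term of weight \<open>\<beta> (k + 1)\<close>, and
  \<open>B i = a * (\<alpha> i)\<^sup>2\<close> bridges the two.

  The probabilistic obstacle is that the law of a draw depends on a random query point, so there is
  no independence to appeal to. The conditional laws have to be turned into a joint law of past and
  draw before the past can be frozen. This presupposes that the iterates are measurable, although
  they are given only as points that minimise something on each path.\<close>

section \<open>Measurability in finite-dimensional normed spaces\<close>

text \<open>Compactness of the l1 unit sphere of coefficients: the norm of the combination is
  continuous there, and its minimum is positive by independence. The reciprocal of that minimum
  serves as \<open>K\<close>.\<close>

lemma coeff_bound_independent:
  fixes C :: "'e::real_normed_vector set"
  assumes "finite C" "independent C"
  obtains K where "K > 0"
    "\<And>c. (\<Sum>b\<in>C. \<bar>c b\<bar>) \<le> K * norm (\<Sum>b\<in>C. c b *\<^sub>R b)"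
proof (cases "C = {}")
  case True
  then show ?thesis using that[of 1] by simp
next
  case False
  \<comment> \<open>Coefficient functions range over all of \<open>'e\<close>; pinning them to 0
    outside \<open>C\<close> makes \<open>Pi\<^sub>E UNIV X\<close> a product of compact
    sets.\<close>
  define X where "X b = (if b \<in> C then {-1..1::real} else {0})" for b
  define S where "S = {c :: 'e \<Rightarrow> real. (\<Sum>b\<in>C. \<bar>c b\<bar>) = 1} \<inter> (Pi\<^sub>E UNIV X)"
  have cont_coord: "continuous_on UNIV (\<lambda>c::'e\<Rightarrow>real. c b)" for b
    by (rule continuous_on_product_coordinates)
  have cont1: "continuous_on UNIV (\<lambda>c::'e\<Rightarrow>real. \<Sum>b\<in>C. \<bar>c b\<bar>)"
    by (intro continuous_intros cont_coord)
  have cont2: "continuous_on UNIV (\<lambda>c::'e\<Rightarrow>real. norm (\<Sum>b\<in>C. c b *\<^sub>R b))"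
    by (intro continuous_intros cont_coord)
  have "compactin (product_topology (\<lambda>i::'e. euclidean) UNIV) (Pi\<^sub>E UNIV X)"
    by (subst compactin_PiE) (auto simp: X_def)
  then have "compact (Pi\<^sub>E UNIV X)"
    by (simp add: euclidean_product_topology)
  moreover have "closed {c :: 'e \<Rightarrow> real. (\<Sum>b\<in>C. \<bar>c b\<bar>) = 1}"
    by (intro closed_Collect_eq cont1 continuous_intros)
  ultimately have "compact S"
    unfolding S_def by (rule closed_Int_compact[rotated])
  moreover have "S \<noteq> {}"
  proof -
    obtain b0 where "b0 \<in> C" using False by blast
    then have "(\<lambda>b. if b = b0 then 1 else 0) \<in> S"
      using assms(1) by (auto simp: S_def X_def if_distrib[of abs] cong: if_cong)
    then show ?thesis by blast
  qed
  ultimately obtain c0 where c0: "c0 \<in> S"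
      "\<And>c. c \<in> S \<Longrightarrow> norm (\<Sum>b\<in>C. c0 b *\<^sub>R b) \<le> norm (\<Sum>b\<in>C. c b *\<^sub>R b)"
    using continuous_attains_inf[of S "\<lambda>c. norm (\<Sum>b\<in>C. c b *\<^sub>R b)"]
      continuous_on_subset[OF cont2] by blast
  define m where "m = norm (\<Sum>b\<in>C. c0 b *\<^sub>R b)"
  have "m > 0"
  proof (rule ccontr)
    assume "\<not> m > 0"
    then have "(\<Sum>b\<in>C. c0 b *\<^sub>R b) = 0" by (simp add: m_def)
    then have "\<forall>b\<in>C. c0 b = 0" using assms by (auto simp: dependent_finite)
    then show False using c0(1) by (simp add: S_def)
  qed
  have "(\<Sum>b\<in>C. \<bar>c b\<bar>) \<le> 1 / m * norm (\<Sum>b\<in>C. c b *\<^sub>R b)" for c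
  proof (cases "(\<Sum>b\<in>C. \<bar>c b\<bar>) = 0")
    case True
    then show ?thesis using \<open>m > 0\<close> by simp
  next
    case False
    define s where "s = (\<Sum>b\<in>C. \<bar>c b\<bar>)"
    have "s > 0" using False sum_nonneg[of C "\<lambda>b. \<bar>c b\<bar>"] by (simp add: s_def less_le)
    define c' where "c' b = (if b \<in> C then c b / s else 0)" for b
    have "\<bar>c b\<bar> \<le> s" if "b \<in> C" for b
      unfolding s_def using assms(1) that by (intro member_le_sum) auto
    then have "- s \<le> c b" "c b \<le> s" if "b \<in> C" for b
      using that by (auto simp: abs_le_iff minus_le_iff)
    then have "c' \<in> S"
      using \<open>s > 0\<close> assms(1)
      by (auto simp: S_def X_def c'_def abs_le_iff divide_le_eq le_divide_eq
          simp flip: sum_divide_distrib s_def cong: sum.cong)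
    then have "m \<le> norm (\<Sum>b\<in>C. c' b *\<^sub>R b)" using c0(2) by (simp add: m_def)
    also have "(\<Sum>b\<in>C. c' b *\<^sub>R b) = (1 / s) *\<^sub>R (\<Sum>b\<in>C. c b *\<^sub>R b)"
      by (simp add: c'_def scaleR_sum_right divide_inverse mult.commute cong: sum.cong)
    finally show ?thesis using \<open>s > 0\<close> \<open>m > 0\<close> by (simp add: s_def[symmetric] field_simps)
  qed
  then show ?thesis using that[of "1 / m"] \<open>m > 0\<close> by simp
qed

text \<open>The coefficient bound says that coordinates are bounded functionals, hence elements of
  the dual. Through them measurability in \<open>'e\<close> and in its dual reduces to finitely many
  real functions.\<close>

lemma finite_dim_coordinates:
  assumes "finite_dim TYPE('e::real_normed_vector)"
  obtains C and c :: "'e::real_normed_vector \<Rightarrow> 'e \<Rightarrow>\<^sub>L real"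
  where "finite C" "\<And>x. x = (\<Sum>b\<in>C. c b x *\<^sub>R b)"
proof -
  obtain b0 :: "'e set" where b0: "finite b0" "span b0 = UNIV"
    using assms by (auto simp: finite_dim_def)
  obtain C where C: "C \<subseteq> b0" "independent C" "b0 \<subseteq> span C"
    using maximal_independent_subset[of b0] by auto
  have "finite C" using C(1) b0(1) by (rule finite_subset)
  have span: "span C = UNIV"
    using b0(2) span_mono[OF C(3)] by (simp add: top.extremum_unique span_span)
  obtain K where K: "K > 0" "\<And>c. (\<Sum>b\<in>C. \<bar>c b\<bar>) \<le> K * norm (\<Sum>b\<in>C. c b *\<^sub>R b)"
    using coeff_bound_independent[OF \<open>finite C\<close> C(2)] by blast
  have rep: "(\<Sum>b\<in>C. representation C x b *\<^sub>R b) = x" for x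
    using sum_representation_eq[OF C(2), of x C] \<open>finite C\<close> span by simp
  have bl: "bounded_linear (\<lambda>x. representation C x b)" if "b \<in> C" for b
  proof (rule bounded_linear_intro[of _ K])
    show "representation C (x + y) b = representation C x b + representation C y b" for x y
      using C(2) span by (simp add: representation_add)
    show "representation C (r *\<^sub>R x) b = r *\<^sub>R representation C x b" for r x
      using C(2) span by (simp add: representation_scale)
    have "\<bar>representation C x b\<bar> \<le> (\<Sum>b\<in>C. \<bar>representation C x b\<bar>)" for x
      using \<open>finite C\<close> that by (intro member_le_sum) auto
    then show "norm (representation C x b) \<le> norm x * K" for x
      using K(2)[of "representation C x"] rep[of x] by (simp add: mult.commute) (meson order_trans)
  qed
  show ?thesis
    by (rule that[of C "\<lambda>b. Blinfun (\<lambda>x. representation C x b)"])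
      (use \<open>finite C\<close> rep bl in \<open>simp_all add: bounded_linear_Blinfun_apply cong: sum.cong\<close>)
qed

text \<open>\<open>X\<close> factors through its coordinates: by \<open>lip\<close> equal
  coordinates give equal points, and the induced map \<open>Z\<close> on the range \<open>D\<close>
  is continuous. Continuity relative to \<open>D\<close> suffices, whatever set \<open>D\<close>
  is.\<close>

lemma borel_measurable_lipschitz_coordinates:
  fixes X :: "'w \<Rightarrow> 'a::metric_space" and t :: "'j \<Rightarrow> 'w \<Rightarrow> real"
  assumes "finite J" and t: "\<And>j. j \<in> J \<Longrightarrow> t j \<in> borel_measurable N"
    and lip: "\<And>v w. v \<in> space N \<Longrightarrow> w \<in> space N \<Longrightarrow>
      dist (X v) (X w) \<le> K * (\<Sum>j\<in>J. \<bar>t j v - t j w\<bar>)"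
  shows "X \<in> borel_measurable N"
proof -
  obtain e where e: "bij_betw e {..<card J} J"
    using ex_bij_betw_nat_finite[OF assms(1)] by (auto simp: atLeast0LessThan)
  \<comment> \<open>Indexing by \<open>nat\<close>, with 0 beyond \<open>card J\<close>, gives a
    countable product, whose Borel sets are generated by the coordinates.\<close>
  define T :: "'w \<Rightarrow> nat \<Rightarrow> real" where
    "T w i = (if i < card J then t (e i) w else 0)" for w i
  have T: "T \<in> borel_measurable N"
  proof (rule measurable_coordinatewise_then_product)
    fix i show "(\<lambda>w. T w i) \<in> borel_measurable N"
      using t bij_betwE[OF e] by (cases "i < card J") (auto simp: T_def)
  qed
  define D where "D = T ` space N"
  define Z where "Z c = X (SOME w. w \<in> space N \<and> T w = c)" for c
  define s where "s c c' = (\<Sum>i<card J. \<bar>c i - c' i\<bar>)" for c c' :: "nat \<Rightarrow> real"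
  have s: "(\<Sum>j\<in>J. \<bar>t j v - t j w\<bar>) = s (T v) (T w)" for v w
    unfolding s_def by (subst sum.reindex_bij_betw[OF e, symmetric]) (simp add: T_def)
  have Zw: "\<exists>v\<in>space N. T v = c \<and> Z c = X v" if "c \<in> D" for c
  proof -
    have "\<exists>w. w \<in> space N \<and> T w = c" using that unfolding D_def by blast
    from someI_ex[OF this] show ?thesis unfolding Z_def by blast
  qed
  have lipZ: "dist (Z c) (Z c') \<le> K * s c c'" if c: "c \<in> D" "c' \<in> D" for c c'
  proof -
    obtain v v' where "v \<in> space N" "T v = c" "Z c = X v" "v' \<in> space N" "T v' = c'" "Z c' = X v'"
      using Zw[OF c(1)] Zw[OF c(2)] by blast
    then show ?thesis using lip[of v v'] unfolding s by simp
  qed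
  have ZT: "Z (T w) = X w" if w: "w \<in> space N" for w
  proof -
    obtain v where "v \<in> space N" "T v = T w" "Z (T w) = X v"
      using Zw[of "T w"] imageI[OF w, of T] unfolding D_def by blast
    then have "dist (X v) (X w) \<le> 0"
      using lip[of v w] w unfolding s by (simp add: s_def)
    then show ?thesis using \<open>Z (T w) = X v\<close> by simp
  qed
  have coord: "continuous_on UNIV (\<lambda>c::nat\<Rightarrow>real. c i)" for i
    by (rule continuous_on_product_coordinates)
  have "continuous_on D Z"
    unfolding continuous_on_def
  proof
    fix c assume "c \<in> D"
    have "continuous_on UNIV (\<lambda>c'. K * s c' c)"
      unfolding s_def by (intro continuous_intros coord)
    then have "continuous_on D (\<lambda>c'. K * s c' c)" by (rule continuous_on_subset) simp
    then have "((\<lambda>c'. K * s c' c) \<longlongrightarrow> K * s c c) (at c within D)"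
      using \<open>c \<in> D\<close> by (simp add: continuous_on_def)
    then have lim: "((\<lambda>c'. K * s c' c) \<longlongrightarrow> 0) (at c within D)"
      by (simp add: s_def[of c c])
    have "\<forall>\<^sub>F c' in at c within D. norm (dist (Z c') (Z c)) \<le> K * s c' c"
      unfolding eventually_at_filter
      by (rule always_eventually) (simp add: lipZ \<open>c \<in> D\<close>)
    from Lim_null_comparison[OF this lim]
    have "((\<lambda>c'. dist (Z c') (Z c)) \<longlongrightarrow> 0) (at c within D)" .
    then show "(Z \<longlongrightarrow> Z c) (at c within D)" by (subst tendsto_dist_iff)
  qed
  then have "Z \<in> borel_measurable (restrict_space borel D)"
    by (rule borel_measurable_continuous_on_restrict)
  moreover have "T \<in> N \<rightarrow>\<^sub>M restrict_space borel D"
    using T by (intro measurable_restrict_space2) (auto simp: D_def)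
  ultimately have "(\<lambda>w. Z (T w)) \<in> borel_measurable N" by (rule measurable_compose[rotated])
  moreover have "X \<in> borel_measurable N \<longleftrightarrow> (\<lambda>w. Z (T w)) \<in> borel_measurable N"
    by (rule measurable_cong) (simp only: ZT)
  ultimately show ?thesis by blast
qed

lemma borel_measurable_finite_dim:
  fixes X :: "'w \<Rightarrow> 'e::real_normed_vector"
  assumes "finite_dim TYPE('e)" and "\<And>g :: 'e \<Rightarrow>\<^sub>L real. (\<lambda>w. g (X w)) \<in> borel_measurable N"
  shows "X \<in> borel_measurable N"
proof -
  obtain C and c :: "'e \<Rightarrow> 'e \<Rightarrow>\<^sub>L real"
    where C: "finite C" "\<And>x. x = (\<Sum>b\<in>C. c b x *\<^sub>R b)"
    using finite_dim_coordinates[OF assms(1)] by blast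
  show ?thesis
  proof (rule borel_measurable_lipschitz_coordinates[OF C(1)])
    show "(\<lambda>w. c b (X w)) \<in> borel_measurable N" for b by (rule assms(2))
    fix v w
    have "norm (X v - X w) = norm (\<Sum>b\<in>C. c b (X v - X w) *\<^sub>R b)"
      by (rule arg_cong[OF C(2)])
    also have "\<dots> \<le> (\<Sum>b\<in>C. \<bar>c b (X v - X w)\<bar> * norm b)"
      by (rule order_trans[OF norm_sum]) simp
    also have "\<dots> \<le> (\<Sum>b\<in>C. \<bar>c b (X v - X w)\<bar> * (\<Sum>b\<in>C. norm b))"
      using C(1) by (intro sum_mono mult_left_mono member_le_sum) auto
    finally show "dist (X v) (X w) \<le> (\<Sum>b\<in>C. norm b) * (\<Sum>b\<in>C. \<bar>c b (X v) - c b (X w)\<bar>)"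
      by (simp add: dist_norm blinfun.diff_right sum_distrib_left mult.commute)
  qed
qed

lemma borel_measurable_blinfun_apply_right:
  fixes g :: "'e::real_normed_vector \<Rightarrow>\<^sub>L real"
  shows "X \<in> borel_measurable N \<Longrightarrow> (\<lambda>w. g (X w)) \<in> borel_measurable N"
  by (rule borel_measurable_continuous_on[where f = "blinfun_apply g"])
    (auto intro!: continuous_intros)

text \<open>The class of \<open>'e\<close> provides no countable base, so the sum is tested on
  functionals, where it becomes a sum of real functions.\<close>

lemma borel_measurable_linear_combination:
  fixes X Y :: "'w \<Rightarrow> 'e::real_normed_vector"
  assumes "finite_dim TYPE('e)" "X \<in> borel_measurable N" "Y \<in> borel_measurable N"
  shows "(\<lambda>w. r *\<^sub>R X w + s *\<^sub>R Y w) \<in> borel_measurable N"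
proof (rule borel_measurable_finite_dim[OF assms(1)])
  fix g :: "'e \<Rightarrow>\<^sub>L real"
  note [measurable] = borel_measurable_blinfun_apply_right[OF assms(2)]
    borel_measurable_blinfun_apply_right[OF assms(3)]
  show "(\<lambda>w. g (r *\<^sub>R X w + s *\<^sub>R Y w)) \<in> borel_measurable N"
    by (simp add: blinfun.add_right blinfun.scaleR_right)
qed

text \<open>The operator norm is controlled by the values on the finite set \<open>C\<close>. This
  yields measurability of the noise norm from the componentwise condition in
  \<open>stochastic_oracle\<close>.\<close>

lemma borel_measurable_blinfun_finite_dim:
  fixes \<eta> :: "'w \<Rightarrow> 'e::real_normed_vector \<Rightarrow>\<^sub>L real"
  assumes "finite_dim TYPE('e)" and "\<And>v. (\<lambda>w. \<eta> w v) \<in> borel_measurable N"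
  shows "\<eta> \<in> borel_measurable N"
proof -
  obtain C and c :: "'e \<Rightarrow> 'e \<Rightarrow>\<^sub>L real"
    where C: "finite C" "\<And>x. x = (\<Sum>b\<in>C. c b x *\<^sub>R b)"
    using finite_dim_coordinates[OF assms(1)] by blast
  define K where "K = (\<Sum>b\<in>C. norm (c b))"
  show ?thesis
  proof (rule borel_measurable_lipschitz_coordinates[OF C(1)])
    show "(\<lambda>w. \<eta> w b) \<in> borel_measurable N" for b by (rule assms(2))
    fix v w
    have "\<bar>(\<eta> v - \<eta> w) x\<bar> \<le> K * (\<Sum>b\<in>C. \<bar>\<eta> v b - \<eta> w b\<bar>) * norm x" for x
    proof -
      have "(\<eta> v - \<eta> w) x = (\<eta> v - \<eta> w) (\<Sum>b\<in>C. c b x *\<^sub>R b)"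
        by (rule arg_cong[OF C(2)])
      also have "\<dots> = (\<Sum>b\<in>C. c b x * (\<eta> v b - \<eta> w b))"
        by (simp add: blinfun.sum_right blinfun.scaleR_right blinfun.diff_left)
      also have "\<bar>\<dots>\<bar> \<le> (\<Sum>b\<in>C. \<bar>c b x\<bar> * \<bar>\<eta> v b - \<eta> w b\<bar>)"
        by (rule order_trans[OF sum_abs]) (simp add: abs_mult)
      also have "\<dots> \<le> (\<Sum>b\<in>C. (K * norm x) * \<bar>\<eta> v b - \<eta> w b\<bar>)"
      proof (intro sum_mono mult_right_mono)
        fix b assume "b \<in> C"
        have "\<bar>c b x\<bar> \<le> norm (c b) * norm x" using norm_blinfun[of "c b" x] by simp
        also have "\<dots> \<le> K * norm x"
          unfolding K_def using C(1) \<open>b \<in> C\<close> by (intro mult_right_mono member_le_sum) auto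
        finally show "\<bar>c b x\<bar> \<le> K * norm x" .
      qed simp
      finally show ?thesis by (simp add: sum_distrib_left mult_ac)
    qed
    then show "dist (\<eta> v) (\<eta> w) \<le> K * (\<Sum>b\<in>C. \<bar>\<eta> v b - \<eta> w b\<bar>)"
      unfolding dist_norm
      by (intro norm_blinfun_bound) (auto simp: K_def intro!: mult_nonneg_nonneg sum_nonneg)
  qed
qed

text \<open>Functional and argument are both random; in coordinates their pairing is a finite sum of
  products of real measurable functions.\<close>

lemma borel_measurable_blinfun_apply_finite_dim:
  fixes \<eta> :: "'w \<Rightarrow> 'e::real_normed_vector \<Rightarrow>\<^sub>L real"
  assumes "finite_dim TYPE('e)" and [measurable]: "\<And>v. (\<lambda>w. \<eta> w v) \<in> borel_measurable N"
    and X: "X \<in> borel_measurable N"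
  shows "(\<lambda>w. \<eta> w (X w)) \<in> borel_measurable N"
proof -
  obtain C and c :: "'e \<Rightarrow> 'e \<Rightarrow>\<^sub>L real"
    where C: "finite C" "\<And>x. x = (\<Sum>b\<in>C. c b x *\<^sub>R b)"
    using finite_dim_coordinates[OF assms(1)] by blast
  note [measurable] = borel_measurable_blinfun_apply_right[OF X]
  have "\<eta> w (X w) = (\<Sum>b\<in>C. c b (X w) * \<eta> w b)" for w
  proof -
    have "\<eta> w (X w) = \<eta> w (\<Sum>b\<in>C. c b (X w) *\<^sub>R b)"
      by (rule arg_cong[OF C(2)])
    then show ?thesis by (simp add: blinfun.sum_right blinfun.scaleR_right)
  qed
  then show ?thesis by simp
qed

section \<open>Prox-functions\<close>

lemma segment_mem:
  fixes z u :: "'e::real_vector"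
  assumes "convex Q" "z \<in> Q" "u \<in> Q" "0 \<le> t" "t \<le> 1"
  shows "z + t *\<^sub>R (u - z) \<in> Q"
proof -
  have "z + t *\<^sub>R (u - z) = (1 - t) *\<^sub>R z + t *\<^sub>R u" by (simp add: algebra_simps)
  then show ?thesis using assms by (simp add: convex_alt)
qed

text \<open>On the segment from \<open>z\<close> to \<open>u\<close> the derivative within
  \<open>Q\<close> becomes a one-sided derivative in one real variable. The sequential form serves
  both for limits of inequalities and for measurability of the gradient.\<close>

lemma difference_quotient_LIMSEQ:
  fixes d :: "'e::real_normed_vector \<Rightarrow> real" and D :: "'e \<Rightarrow>\<^sub>L real"
  assumes "(d has_derivative D) (at z within Q)" "convex Q" "z \<in> Q" "u \<in> Q"
  shows "(\<lambda>n. real (Suc n) * (d (z + (1 / real (Suc n)) *\<^sub>R (u - z)) - d z)) \<longlonglongrightarrow> D (u - z)"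
proof -
  define g where "g t = z + t *\<^sub>R (u - z)" for t :: real
  have g: "(g has_derivative (\<lambda>t. t *\<^sub>R (u - z))) (at 0 within {0..1})"
    unfolding g_def by (auto intro!: derivative_eq_intros)
  have "g ` {0..1} \<subseteq> Q" using assms(2-4) by (auto simp: g_def intro!: segment_mem)
  then have "(d has_derivative D) (at (g 0) within g ` {0..1})"
    using assms(1) has_derivative_subset by (auto simp: g_def)
  from diff_chain_within[OF g this]
  have "((d \<circ> g) has_derivative (\<lambda>t. t * D (u - z))) (at 0 within {0..1})"
    by (simp add: o_def blinfun.scaleR_right)
  then have "((d \<circ> g) has_field_derivative D (u - z)) (at 0 within {0..1})"
    by (simp add: has_field_derivative_def mult.commute[of _ "D (u - z)"])
  then have lim: "((\<lambda>t. ((d \<circ> g) t - (d \<circ> g) 0) / (t - 0)) \<longlongrightarrow> D (u - z)) (at 0 within {0..1})"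
    by (simp add: has_field_derivative_iff)
  have "filterlim (\<lambda>n. 1 / real (Suc n)) (at 0 within {0..1}) sequentially"
    unfolding filterlim_at using LIMSEQ_inverse_real_of_nat
    by (auto simp: inverse_eq_divide field_simps intro!: always_eventually)
  from filterlim_compose[OF lim this] show ?thesis
    by (simp add: g_def mult.commute)
qed

locale prox_setup =
  fixes Q :: "'e::real_normed_vector set" and d :: "'e \<Rightarrow> real" and grad_d x0
  assumes prox: "prox_function Q d grad_d x0"
begin

lemma Q_convex: "convex Q" and x0_mem: "x0 \<in> Q" and d_x0: "d x0 = 0"
  and d_ge: "u \<in> Q \<Longrightarrow> d u \<ge> 1 / 2 * (norm (u - x0))\<^sup>2"
  and grad: "u \<in> Q \<Longrightarrow> (d has_derivative grad_d u) (at u within Q)"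
  and d_sc: "\<lbrakk>u \<in> Q; v \<in> Q; 0 \<le> t; t \<le> 1\<rbrakk> \<Longrightarrow>
    d (t *\<^sub>R u + (1 - t) *\<^sub>R v) \<le> t * d u + (1 - t) * d v - 1 / 2 * t * (1 - t) * (norm (u - v))\<^sup>2"
  using prox by (auto simp: prox_function_def strongly_convex_on_def is_arg_min_def)

lemma d_nonneg: "u \<in> Q \<Longrightarrow> d u \<ge> 0"
  by (rule order_trans[OF _ d_ge]) simp_all

lemma arg_min_eq_x0: "is_arg_min d (\<lambda>u. u \<in> Q) v \<Longrightarrow> v = x0"
proof -
  assume v: "is_arg_min d (\<lambda>u. u \<in> Q) v"
  then have "v \<in> Q" "d v \<le> d x0" using x0_mem by (auto simp: is_arg_min_linorder)
  then have "(norm (v - x0))\<^sup>2 \<le> 0" using d_ge[of v] d_x0 by linarith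
  then show ?thesis by simp
qed

lemma grad_LIMSEQ: "z \<in> Q \<Longrightarrow> u \<in> Q \<Longrightarrow>
  (\<lambda>n. real (Suc n) * (d (z + (1 / real (Suc n)) *\<^sub>R (u - z)) - d z)) \<longlonglongrightarrow> grad_d z (u - z)"
  by (rule difference_quotient_LIMSEQ[OF grad Q_convex])

text \<open>Strong convexity along the segment is divided by \<open>t\<close>; as \<open>t\<close>
  tends to 0 the factor \<open>1 - t\<close> tends to 1, which leaves the full constant 1/2.\<close>

lemma bregman_ge:
  assumes "u \<in> Q" "z \<in> Q"
  shows "bregman d grad_d u z \<ge> 1 / 2 * (norm (u - z))\<^sup>2"
proof -
  define t where "t n = 1 / real (Suc n)" for n
  have t0: "t \<longlonglongrightarrow> 0" unfolding t_def using LIMSEQ_inverse_real_of_nat by (simp add: inverse_eq_divide)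
  have "(\<lambda>n. d u - d z - 1 / 2 * (1 - t n) * (norm (u - z))\<^sup>2) \<longlonglongrightarrow> d u - d z - 1 / 2 * (1 - 0) * (norm (u - z))\<^sup>2"
    by (intro tendsto_intros t0)
  moreover have "real (Suc n) * (d (z + (1 / real (Suc n)) *\<^sub>R (u - z)) - d z)
      \<le> d u - d z - 1 / 2 * (1 - t n) * (norm (u - z))\<^sup>2" for n
  proof -
    have t: "t n > 0" "t n \<le> 1" "real (Suc n) = 1 / t n" by (auto simp: t_def)
    have "z + t n *\<^sub>R (u - z) = t n *\<^sub>R u + (1 - t n) *\<^sub>R z" by (simp add: algebra_simps)
    then have "d (z + t n *\<^sub>R (u - z)) - d z \<le> t n * (d u - d z - 1 / 2 * (1 - t n) * (norm (u - z))\<^sup>2)"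
      using d_sc[OF assms, of "t n"] t by (simp add: algebra_simps)
    then show ?thesis using t by (simp add: divide_le_eq mult.commute)
  qed
  ultimately have "grad_d z (u - z) \<le> d u - d z - 1 / 2 * (norm (u - z))\<^sup>2"
    using LIMSEQ_le[OF grad_LIMSEQ[OF assms(2,1)]] by simp
  then show ?thesis by (simp add: bregman_def)
qed

text \<open>First-order optimality without a subgradient of \<open>h\<close>: on the segment towards
  \<open>u\<close>, convexity bounds the increment of \<open>h\<close> linearly in \<open>t\<close>,
  and only \<open>d\<close> is differentiated. The Bregman remainder of \<open>d\<close> then
  accounts for the gap.\<close>

lemma arg_min_bregman_gap:
  fixes s :: "'e \<Rightarrow>\<^sub>L real"
  assumes h: "convex_on Q h" and "\<beta> \<ge> 0" "c \<ge> 0"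
    and \<psi>: "\<And>u. u \<in> Q \<Longrightarrow> \<psi> u = \<beta> * d u + s u + c * h u + r"
    and z: "is_arg_min \<psi> (\<lambda>u. u \<in> Q) z" and u: "u \<in> Q"
  shows "\<psi> z + \<beta> * bregman d grad_d u z \<le> \<psi> u"
proof -
  have zQ: "z \<in> Q" and min: "\<And>v. v \<in> Q \<Longrightarrow> \<psi> z \<le> \<psi> v"
    using z by (auto simp: is_arg_min_linorder)
  define q where "q n = real (Suc n) * (d (z + (1 / real (Suc n)) *\<^sub>R (u - z)) - d z)" for n
  have "0 \<le> \<beta> * q n + s (u - z) + c * (h u - h z)" for n
  proof -
    define t where "t = 1 / real (Suc n)"
    have t: "t > 0" "t \<le> 1" "real (Suc n) = 1 / t" by (auto simp: t_def)
    let ?v = "z + t *\<^sub>R (u - z)"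
    have v: "?v \<in> Q" using segment_mem[OF Q_convex zQ u] t by simp
    have "?v = (1 - t) *\<^sub>R z + t *\<^sub>R u" by (simp add: algebra_simps)
    then have "h ?v \<le> (1 - t) * h z + t * h u"
      using convex_onD[OF h, of t z u] t zQ u by simp
    then have "c * h ?v \<le> c * ((1 - t) * h z + t * h u)"
      using \<open>c \<ge> 0\<close> by (rule mult_left_mono)
    moreover have "s ?v = s z + t * s (u - z)"
      by (simp add: blinfun.add_right blinfun.scaleR_right)
    ultimately have "0 \<le> \<beta> * (d ?v - d z) + t * s (u - z) + t * (c * (h u - h z))"
      using min[OF v] \<psi>[OF v] \<psi>[OF zQ] by (simp add: algebra_simps)
    also have "\<dots> = t * (\<beta> * q n + s (u - z) + c * (h u - h z))"
      using t(1) unfolding q_def t(3) by (simp add: field_simps)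
    finally show ?thesis using t(1) by (simp add: zero_le_mult_iff)
  qed
  moreover have "(\<lambda>n. \<beta> * q n + s (u - z) + c * (h u - h z))
      \<longlonglongrightarrow> \<beta> * grad_d z (u - z) + s (u - z) + c * (h u - h z)"
    unfolding q_def by (intro tendsto_intros grad_LIMSEQ zQ u)
  ultimately have "0 \<le> \<beta> * grad_d z (u - z) + s (u - z) + c * (h u - h z)"
    by (intro LIMSEQ_le_const) auto
  then show ?thesis
    using \<psi>[OF zQ] \<psi>[OF u] by (simp add: bregman_def blinfun.diff_right algebra_simps)
qed

text \<open>Each minimiser is tested at the other; adding the two gaps cancels \<open>d\<close> and
  \<open>h\<close>. For positive \<open>\<beta>\<close> this gives uniqueness and Lipschitz
  dependence on the linear part.\<close>

lemma arg_min_monotone: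
  fixes s s' :: "'e \<Rightarrow>\<^sub>L real"
  assumes h: "convex_on Q h" and "\<beta> \<ge> 0" "c \<ge> 0"
    and z: "is_arg_min (\<lambda>u. \<beta> * d u + s u + c * h u) (\<lambda>u. u \<in> Q) z"
    and z': "is_arg_min (\<lambda>u. \<beta> * d u + s' u + c * h u) (\<lambda>u. u \<in> Q) z'"
  shows "\<beta> * (norm (z - z'))\<^sup>2 \<le> (s - s') (z' - z)"
proof -
  have Q: "z \<in> Q" "z' \<in> Q" using z z' by (auto simp: is_arg_min_linorder)
  have "\<beta> * (1 / 2 * (norm (z' - z))\<^sup>2) \<le> \<beta> * bregman d grad_d z' z"
    "\<beta> * (1 / 2 * (norm (z - z'))\<^sup>2) \<le> \<beta> * bregman d grad_d z z'"
    by (intro mult_left_mono bregman_ge Q \<open>\<beta> \<ge> 0\<close>)+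
  with arg_min_bregman_gap[OF h assms(2,3) _ z Q(2), where r=0 and s=s]
       arg_min_bregman_gap[OF h assms(2,3) _ z' Q(1), where r=0 and s=s']
  show ?thesis by (simp add: blinfun.diff_left blinfun.diff_right norm_minus_commute algebra_simps)
qed

end


section \<open>Measurability of gradients and of prox-step minimisers\<close>

context prox_setup
begin

text \<open>\<open>grad_d\<close> is an arbitrary choice of gradient, determined only on differences
  of points of \<open>Q\<close>, hence the restriction to \<open>u - u'\<close>. Such values come
  from limits of difference quotients that are continuous in the base point.\<close>

lemma grad_measurable:
  assumes X: "X \<in> N \<rightarrow>\<^sub>M restrict_space borel Q" and u: "u \<in> Q" and u': "u' \<in> Q"
  shows "(\<lambda>\<omega>. grad_d (X \<omega>) (u - u')) \<in> borel_measurable N"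
proof -
  have XQ: "X \<omega> \<in> Q" if "\<omega> \<in> space N" for \<omega>
    using measurable_space[OF X that] by (simp add: space_restrict_space)
  have dc: "continuous_on Q d"
    by (rule has_derivative_continuous_on) (rule grad)
  have 1: "(\<lambda>\<omega>. grad_d (X \<omega>) (q - X \<omega>)) \<in> borel_measurable N" if q: "q \<in> Q" for q
  proof (rule borel_measurable_LIMSEQ_real)
    show "(\<lambda>n. real (Suc n) * (d (X \<omega> + (1 / real (Suc n)) *\<^sub>R (q - X \<omega>)) - d (X \<omega>)))
        \<longlonglongrightarrow> grad_d (X \<omega>) (q - X \<omega>)" if "\<omega> \<in> space N" for \<omega>
      by (rule grad_LIMSEQ[OF XQ[OF that] q])
    fix n
    have "continuous_on Q (\<lambda>z. real (Suc n) * (d (z + (1 / real (Suc n)) *\<^sub>R (q - z)) - d z))"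
    proof (intro continuous_intros dc)
      show "continuous_on Q (\<lambda>z. d (z + (1 / real (Suc n)) *\<^sub>R (q - z)))"
        by (rule continuous_on_compose2[OF dc])
          (auto intro!: continuous_intros segment_mem Q_convex q)
    qed
    from measurable_compose[OF X borel_measurable_continuous_on_restrict[OF this]]
    show "(\<lambda>\<omega>. real (Suc n) * (d (X \<omega> + (1 / real (Suc n)) *\<^sub>R (q - X \<omega>)) - d (X \<omega>)))
        \<in> borel_measurable N" .
  qed
  have "(\<lambda>\<omega>. grad_d (X \<omega>) (u - X \<omega>) - grad_d (X \<omega>) (u' - X \<omega>)) \<in> borel_measurable N"
    by (intro borel_measurable_diff 1 u u')
  then show ?thesis by (simp add: blinfun.diff_right)
qed

lemma arg_min_measurable:
  fixes s :: "'w \<Rightarrow> 'e \<Rightarrow>\<^sub>L real"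
  assumes fd: "finite_dim TYPE('e)" and h: "convex_on Q h" and "\<beta> > 0" "c \<ge> 0"
    and z: "\<And>\<omega>. \<omega> \<in> space N \<Longrightarrow> is_arg_min (\<lambda>u. \<beta> * d u + s \<omega> u + c * h u) (\<lambda>u. u \<in> Q) (z \<omega>)"
    and s: "\<And>u. u \<in> Q \<Longrightarrow> (\<lambda>\<omega>. s \<omega> (u - x0)) \<in> borel_measurable N"
  shows "z \<in> borel_measurable N"
proof -
  \<comment> \<open>The basis spans \<open>Q - x0\<close> instead of the whole space:
    \<open>s\<close> will contain \<open>grad_d\<close>, which is known to be measurable only on
    such differences. Differences of minimisers lie in this span.\<close>
  define D where "D = (\<lambda>u. u - x0) ` Q"
  obtain C where C: "C \<subseteq> D" "independent C" "D \<subseteq> span C"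
    using maximal_independent_subset[of D] by auto
  obtain b0 :: "'e set" where b0: "finite b0" "span b0 = UNIV"
    using fd by (auto simp: finite_dim_def)
  have fin: "finite C" using independent_span_bound[OF b0(1) C(2)] b0(2) by simp
  obtain K where K: "K > 0" "\<And>c. (\<Sum>b\<in>C. \<bar>c b\<bar>) \<le> K * norm (\<Sum>b\<in>C. c b *\<^sub>R b)"
    using coeff_bound_independent[OF fin C(2)] by blast
  show ?thesis
  proof (rule borel_measurable_lipschitz_coordinates[OF fin])
    show "(\<lambda>\<omega>. s \<omega> b) \<in> borel_measurable N" if "b \<in> C" for b
      using that C(1) s by (auto simp: D_def)
    fix v w assume v: "v \<in> space N" and w: "w \<in> space N"
    have Q: "z v \<in> Q" "z w \<in> Q" using z[OF v] z[OF w] by (auto simp: is_arg_min_linorder)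
    define n T where "n = norm (z v - z w)" and "T = (\<Sum>b\<in>C. \<bar>s v b - s w b\<bar>)"
    have "z w - x0 \<in> span C" "z v - x0 \<in> span C" using Q C(3) by (auto simp: D_def)
    then have "(z w - x0) - (z v - x0) \<in> span C" by (rule span_diff)
    then have "z w - z v \<in> span C" by simp
    then obtain r where r: "z w - z v = (\<Sum>b\<in>C. r b *\<^sub>R b)"
      using span_finite[OF fin] by auto
    have "\<beta> * n\<^sup>2 \<le> (s v - s w) (z w - z v)"
      using arg_min_monotone[OF h _ \<open>c \<ge> 0\<close> z[OF v] z[OF w]] \<open>\<beta> > 0\<close> by (simp add: n_def)
    also have "\<dots> = (\<Sum>b\<in>C. r b * (s v b - s w b))"
      unfolding r by (simp add: blinfun.sum_right blinfun.scaleR_right blinfun.diff_left)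
    also have "\<dots> \<le> (\<Sum>b\<in>C. \<bar>r b\<bar> * T)"
    proof (intro sum_mono)
      fix b assume b: "b \<in> C"
      have "r b * (s v b - s w b) \<le> \<bar>r b\<bar> * \<bar>s v b - s w b\<bar>" by (metis abs_ge_self abs_mult)
      also have "\<dots> \<le> \<bar>r b\<bar> * T"
        unfolding T_def using fin b by (intro mult_left_mono member_le_sum) auto
      finally show "r b * (s v b - s w b) \<le> \<bar>r b\<bar> * T" .
    qed
    also have "\<dots> = (\<Sum>b\<in>C. \<bar>r b\<bar>) * T" by (simp add: sum_distrib_right)
    also have "\<dots> \<le> K * n * T"
      using K(2)[of r] unfolding r[symmetric]
      by (intro mult_right_mono) (auto simp: n_def norm_minus_commute T_def intro!: sum_nonneg)
    finally have *: "\<beta> * n\<^sup>2 \<le> K * n * T" .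
    have "n \<le> K / \<beta> * T"
    proof (cases "n = 0")
      case True
      then show ?thesis using K(1) \<open>\<beta> > 0\<close> by (auto simp: T_def intro!: mult_nonneg_nonneg sum_nonneg)
    next
      case False
      then have "n > 0" by (simp add: n_def)
      have "n * (\<beta> * n) \<le> n * (K * T)" using * by (simp add: power2_eq_square mult_ac)
      then have "\<beta> * n \<le> K * T" using \<open>n > 0\<close> by simp
      then show ?thesis using \<open>\<beta> > 0\<close> by (simp add: field_simps)
    qed
    then show "dist (z v) (z w) \<le> K / \<beta> * (\<Sum>b\<in>C. \<bar>s v b - s w b\<bar>)"
      by (simp add: dist_norm n_def T_def)
  qed
qed

end

section \<open>The pathwise inequality\<close>

text \<open>Young's inequality: the surplus curvature \<open>\<beta> - L\<close> absorbs the product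
  of the noise norm and the displacement.\<close>

lemma inexact_oracle_upper:
  fixes \<gamma> :: "'e::real_normed_vector \<Rightarrow>\<^sub>L real"
  assumes or: "inexact_oracle Q f \<delta> L f\<^sub>o g\<^sub>o" and Q: "u \<in> Q" "v \<in> Q"
    and \<beta>: "L \<le> \<beta>" "\<beta> = L \<Longrightarrow> \<gamma> = g\<^sub>o u"
  shows "f v \<le> f\<^sub>o u + \<gamma> (v - u) + \<beta> / 2 * (norm (v - u))\<^sup>2 + \<delta> + (norm (\<gamma> - g\<^sub>o u))\<^sup>2 / (2 * (\<beta> - L))"
proof -
  define n e where "n = norm (v - u)" and "e = norm (\<gamma> - g\<^sub>o u)"
  have 1: "f v \<le> f\<^sub>o u + g\<^sub>o u (v - u) + L / 2 * n\<^sup>2 + \<delta>"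
    using or[unfolded inexact_oracle_def, rule_format, OF Q]
    by (simp add: n_def norm_minus_commute)
  have "\<bar>(\<gamma> - g\<^sub>o u) (v - u)\<bar> \<le> e * n"
    using norm_blinfun[of "\<gamma> - g\<^sub>o u" "v - u"] by (simp add: e_def n_def)
  then have 2: "g\<^sub>o u (v - u) \<le> \<gamma> (v - u) + e * n"
    by (simp add: blinfun.diff_left abs_le_iff)
  have "e * n \<le> (\<beta> - L) / 2 * n\<^sup>2 + e\<^sup>2 / (2 * (\<beta> - L))"
  proof (cases "\<beta> = L")
    \<comment> \<open>The quotient is 0 by \<open>x / 0 = 0\<close>, and
      \<open>\<gamma> = g\<^sub>o u\<close> removes the cross term.\<close>
    case True
    then show ?thesis using \<beta>(2) by (simp add: e_def)
  next
    case False
    then have p: "\<beta> - L > 0" using \<beta>(1) by simp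
    have "(\<beta> - L) / 2 * n\<^sup>2 + e\<^sup>2 / (2 * (\<beta> - L)) - e * n = ((\<beta> - L) * n - e)\<^sup>2 / (2 * (\<beta> - L))"
      using p by (simp add: field_simps power2_eq_square)
    also have "\<dots> \<ge> 0" using p by simp
    finally show ?thesis by simp
  qed
  then show ?thesis using 1 2 unfolding n_def[symmetric] e_def[symmetric]
    by (simp add: left_diff_distrib diff_divide_distrib)
qed

text \<open>The step sizes enter the pathwise argument only through these inequalities.
  \<open>step_cond\<close> lets a Bregman term of weight \<open>\<beta> i\<close> pay for a
  quadratic term of weight \<open>\<beta> (Suc i)\<close>.\<close>

locale sigm_run = prox_setup Q d grad_d x0
  for Q :: "'e::real_normed_vector set" and d grad_d x0 +
  fixes f h :: "'e \<Rightarrow> real" and f\<^sub>o g\<^sub>o and L \<delta> :: real and \<alpha> \<beta> B :: "nat \<Rightarrow> real"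
    and \<gamma> and x y z xhat w :: "nat \<Rightarrow> 'e"
  assumes f: "convex_on Q f" and h: "convex_on Q h"
    and inexact: "inexact_oracle Q f \<delta> L f\<^sub>o g\<^sub>o"
    and L_pos: "L > 0"
    and \<alpha>_pos: "\<alpha> i > 0" and \<alpha>_0: "\<alpha> 0 \<le> 1" and B_0: "B 0 = \<alpha> 0"
    and \<alpha>_le_B: "\<alpha> i \<le> B i" and B_le_A: "B i \<le> (\<Sum>j\<le>i. \<alpha> j)"
    and \<beta>_ge: "L \<le> \<beta> i" and \<beta>_mono: "\<beta> i \<le> \<beta> (Suc i)"
    and step_cond: "(\<alpha> (Suc i))\<^sup>2 * \<beta> (Suc i) \<le> B (Suc i) * \<beta> i"
    and run: "SIGM Q h d grad_d \<alpha> \<beta> B \<gamma> x y z xhat w"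
begin

definition "A k = (\<Sum>i\<le>k. \<alpha> i)"
definition "\<tau> k = \<alpha> (Suc k) / B (Suc k)"

lemma run_x0: "x 0 = x0"
  using run by (auto simp: SIGM_def Let_def intro: arg_min_eq_x0)

lemma run_y0: "is_arg_min (\<lambda>u. \<beta> 0 * d u + \<alpha> 0 * \<gamma> 0 (u - x 0) + \<alpha> 0 * h u) (\<lambda>u. u \<in> Q) (y 0)"
  and run_z: "is_arg_min (\<lambda>u. \<beta> k * d u + (\<Sum>i\<le>k. \<alpha> i * \<gamma> i (u - x i)) + A k * h u)
           (\<lambda>u. u \<in> Q) (z k)"
  and run_x: "x (Suc k) = \<tau> k *\<^sub>R z k + (1 - \<tau> k) *\<^sub>R y k"
  and run_xhat: "is_arg_min (\<lambda>u. \<beta> k * bregman d grad_d u (z k)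
                + \<alpha> (Suc k) * \<gamma> (Suc k) (u - z k) + \<alpha> (Suc k) * h u)
           (\<lambda>u. u \<in> Q) (xhat (Suc k))"
  and run_w: "w (Suc k) = \<tau> k *\<^sub>R xhat (Suc k) + (1 - \<tau> k) *\<^sub>R y k"
  and run_y: "y (Suc k) = ((A (Suc k) - B (Suc k)) / A (Suc k)) *\<^sub>R y k
                     + (B (Suc k) / A (Suc k)) *\<^sub>R w (Suc k)"
  using run by (auto simp: SIGM_def Let_def A_def[abs_def] \<tau>_def[abs_def])

lemma B_pos: "B i > 0" using \<alpha>_pos[of i] \<alpha>_le_B[of i] by simp
lemma A_pos: "A i > 0" using B_pos[of i] B_le_A[of i] by (simp add: A_def)
lemma \<beta>_pos: "\<beta> i > 0" using \<beta>_ge[of i] L_pos by simp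
lemma \<tau>_bounds: "0 \<le> \<tau> k" "\<tau> k \<le> 1"
  using \<alpha>_le_B[of "Suc k"] \<alpha>_pos[of "Suc k"] B_pos[of "Suc k"] by (auto simp: \<tau>_def)

lemma z_mem: "z k \<in> Q" and xhat_mem: "xhat (Suc k) \<in> Q" and y0_mem: "y 0 \<in> Q"
  using run_z[of k] run_xhat[of k] run_y0 by (auto simp: is_arg_min_linorder)

lemma comb_mem: "u \<in> Q \<Longrightarrow> v \<in> Q \<Longrightarrow> 0 \<le> t \<Longrightarrow> t \<le> 1 \<Longrightarrow> t *\<^sub>R u + (1 - t) *\<^sub>R v \<in> Q"
  using Q_convex by (simp add: convex_alt)
    (metis add_diff_cancel_left' convex_def diff_add_cancel diff_ge_0_iff_ge)

lemma run_y': "y (Suc k) = (B (Suc k) / A (Suc k)) *\<^sub>R w (Suc k) + (1 - B (Suc k) / A (Suc k)) *\<^sub>R y k"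
  using run_y[of k] A_pos[of "Suc k"] by (simp add: diff_divide_distrib add.commute)

lemma BA_bounds: "0 \<le> B k / A k" "B k / A k \<le> 1"
  using B_pos[of k] A_pos[of k] B_le_A[of k] by (auto simp: A_def)

lemma y_mem: "y k \<in> Q"
proof (induction k)
  case (Suc k)
  have "w (Suc k) \<in> Q"
    unfolding run_w by (intro comb_mem xhat_mem Suc \<tau>_bounds)
  then show ?case unfolding run_y' by (intro comb_mem Suc BA_bounds)
qed (rule y0_mem)

lemma w_mem: "w (Suc k) \<in> Q"
  unfolding run_w by (intro comb_mem xhat_mem y_mem \<tau>_bounds)

lemma x_mem: "x k \<in> Q"
proof (cases k)
  case 0 then show ?thesis using run_x0 x0_mem by simp
next
  case (Suc j) then show ?thesis by (simp add: run_x comb_mem z_mem y_mem \<tau>_bounds)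
qed

section \<open>The estimate sequence along one path\<close>

definition "\<eta> i = \<gamma> i - g\<^sub>o (x i)"

definition "\<phi> u = f u + h u"

text \<open>The branch for \<open>i = 0\<close> only makes \<open>v xs 0\<close> independent of the first draw: its coefficient
  vanishes since \<open>B 0 = \<alpha> 0\<close>.\<close>

definition "v xs i = \<alpha> i *\<^sub>R (xs - x i) + (B i - \<alpha> i) *\<^sub>R ((if i = 0 then x 0 else y (i - 1)) - x i)"

definition "\<psi> k u = \<beta> k * d u + (\<Sum>i\<le>k. \<alpha> i * (f\<^sub>o (x i) + \<gamma> i (u - x i))) + A k * h u"

text \<open>The errors collected by the induction on \<open>k\<close>. Noise paired with
  \<open>xs - x i\<close> is absent: it arises only when the model is evaluated at
  \<open>xs\<close>.\<close>

definition "Er k = (\<Sum>i\<le>k. B i * \<delta> + B i * (norm (\<eta> i))\<^sup>2 / (2 * (\<beta> i - L))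
   + (B i - \<alpha> i) * \<eta> i ((if i = 0 then x 0 else y (i - 1)) - x i))"

lemma \<psi>_linear: "\<psi> k u = \<beta> k * d u + (\<Sum>i\<le>k. \<alpha> i *\<^sub>R \<gamma> i) u + A k * h u
   + (\<Sum>i\<le>k. \<alpha> i * (f\<^sub>o (x i) - \<gamma> i (x i)))"
  by (simp add: \<psi>_def blinfun.sum_left blinfun.scaleR_left blinfun.diff_right algebra_simps
      sum.distrib sum_subtractf)

text \<open>The values \<open>f\<^sub>o (x i)\<close> add a constant in \<open>u\<close>, so the
  model has the same minimiser as the objective of the method, in which they do not occur.\<close>

lemma z_arg_min_\<psi>: "is_arg_min (\<psi> k) (\<lambda>u. u \<in> Q) (z k)"
proof -
  have "\<psi> k u = \<beta> k * d u + (\<Sum>i\<le>k. \<alpha> i * \<gamma> i (u - x i)) + A k * h u + (\<Sum>i\<le>k. \<alpha> i * f\<^sub>o (x i))" for u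
    by (simp add: \<psi>_def algebra_simps sum.distrib)
  then show ?thesis using run_z[of k] by (simp add: is_arg_min_linorder)
qed

lemma \<psi>_gap: "u \<in> Q \<Longrightarrow> \<psi> k (z k) + \<beta> k * bregman d grad_d u (z k) \<le> \<psi> k u"
  using arg_min_bregman_gap[OF h _ _ \<psi>_linear z_arg_min_\<psi>] \<beta>_pos[of k] A_pos[of k] by simp

lemma f_upper: "u \<in> Q \<Longrightarrow> (\<beta> i = L \<Longrightarrow> \<eta> i = 0) \<Longrightarrow>
  f u \<le> f\<^sub>o (x i) + \<gamma> i (u - x i) + \<beta> i / 2 * (norm (u - x i))\<^sup>2 + \<delta> + (norm (\<eta> i))\<^sup>2 / (2 * (\<beta> i - L))"
  unfolding \<eta>_def by (rule inexact_oracle_upper[OF inexact x_mem _ \<beta>_ge]) auto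

lemma f_lower: "u \<in> Q \<Longrightarrow> f\<^sub>o (x i) + g\<^sub>o (x i) (u - x i) \<le> f u"
  using inexact[unfolded inexact_oracle_def, rule_format, OF x_mem[of i], of u] by simp

text \<open>\<open>y 0\<close> and \<open>z 0\<close> minimise the same function up to a constant,
  so the minimum of the model can be read off at \<open>y 0\<close>, where the oracle bound is
  applied.\<close>

lemma \<psi>_lower_0:
  assumes "\<beta> 0 = L \<Longrightarrow> \<eta> 0 = 0"
  shows "A 0 * \<phi> (y 0) \<le> \<psi> 0 (z 0) + Er 0"
proof -
  have "\<psi> 0 u = \<beta> 0 * d u + \<alpha> 0 * \<gamma> 0 (u - x 0) + \<alpha> 0 * h u + \<alpha> 0 * f\<^sub>o (x 0)" for u
    by (simp add: \<psi>_def A_def algebra_simps)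
  then have y: "is_arg_min (\<psi> 0) (\<lambda>u. u \<in> Q) (y 0)"
    using run_y0 by (simp add: is_arg_min_linorder)
  then have eq: "\<psi> 0 (y 0) = \<psi> 0 (z 0)"
    using z_arg_min_\<psi>[of 0] by (auto simp: is_arg_min_linorder intro: antisym)
  \<comment> \<open>The prox term has full weight \<open>\<beta> 0\<close>, the quadratic term of
    the oracle only \<open>\<alpha> 0 * \<beta> 0\<close>; here \<open>\<alpha> 0 \<le> 1\<close> is
    decisive.\<close>
  have "\<alpha> 0 * (\<beta> 0 / 2 * (norm (y 0 - x 0))\<^sup>2) \<le> 1 * (\<beta> 0 / 2 * (norm (y 0 - x 0))\<^sup>2)"
    using \<alpha>_0 \<beta>_pos[of 0] by (intro mult_right_mono) auto
  also have "\<dots> \<le> \<beta> 0 * d (y 0)"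
    using mult_left_mono[OF d_ge[OF y_mem[of 0]], of "\<beta> 0"] \<beta>_pos[of 0] by (simp add: run_x0)
  finally have 1: "\<alpha> 0 * (\<beta> 0 / 2 * (norm (y 0 - x 0))\<^sup>2) \<le> \<beta> 0 * d (y 0)" .
  have "\<alpha> 0 * f (y 0) \<le> \<alpha> 0 * (f\<^sub>o (x 0) + \<gamma> 0 (y 0 - x 0) + \<beta> 0 / 2 * (norm (y 0 - x 0))\<^sup>2 + \<delta>
      + (norm (\<eta> 0))\<^sup>2 / (2 * (\<beta> 0 - L)))"
    using \<alpha>_pos[of 0] f_upper[OF y_mem assms] by (intro mult_left_mono) auto
  with 1 show ?thesis
    unfolding eq[symmetric] by (simp add: \<psi>_def Er_def A_def \<phi>_def B_0 algebra_simps)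
qed

text \<open>The oracle upper bound at \<open>w\<close> has weight \<open>B\<close>, while the model
  gains only \<open>\<alpha>\<close>. The excess \<open>B - \<alpha>\<close> is covered by the lower
  bound at \<open>y k\<close>; there the true gradient meets the stochastic one, which leaves the
  linear noise term of \<open>Er\<close>.\<close>

lemma \<psi>_lower_Suc:
  assumes IH: "A k * \<phi> (y k) \<le> \<psi> k (z k) + Er k"
    and \<eta>: "\<beta> (Suc k) = L \<Longrightarrow> \<eta> (Suc k) = 0"
  shows "A (Suc k) * \<phi> (y (Suc k)) \<le> \<psi> (Suc k) (z (Suc k)) + Er (Suc k)"
proof -
  let ?k = "Suc k"
  let ?x = "x ?k" and ?w = "w ?k" and ?h = "xhat ?k" and ?\<gamma> = "\<gamma> ?k" and ?f = "f\<^sub>o (x ?k)"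
  let ?\<alpha> = "\<alpha> ?k" and ?B = "B ?k" and ?t = "\<tau> k"
  have \<alpha>: "?\<alpha> = ?t * ?B" using B_pos[of ?k] by (simp add: \<tau>_def)
  have A: "A ?k = A k + ?\<alpha>" by (simp add: A_def)
  have "\<beta> k * d (z ?k) \<le> \<beta> ?k * d (z ?k)"
    using \<beta>_mono d_nonneg[OF z_mem] by (rule mult_right_mono)
  then have "\<psi> ?k (z ?k) \<ge> \<psi> k (z ?k) + ?\<alpha> * (?f + ?\<gamma> (z ?k - ?x)) + ?\<alpha> * h (z ?k)"
    by (simp add: \<psi>_def A algebra_simps)
  \<comment> \<open>Optimality of \<open>xhat\<close>, tested at \<open>z (Suc k)\<close>, trades
    the next minimiser for the point from which \<open>w\<close> is built.\<close>
  moreover have "\<beta> k * bregman d grad_d ?h (z k) + ?\<alpha> * ?\<gamma> (?h - z k) + ?\<alpha> * h ?h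
      \<le> \<beta> k * bregman d grad_d (z ?k) (z k) + ?\<alpha> * ?\<gamma> (z ?k - z k) + ?\<alpha> * h (z ?k)"
    using run_xhat[of k] z_mem by (simp add: is_arg_min_linorder)
  ultimately have 1: "\<psi> ?k (z ?k) \<ge> \<psi> k (z k) + \<beta> k * bregman d grad_d ?h (z k)
      + ?\<alpha> * (?f + ?\<gamma> (?h - ?x)) + ?\<alpha> * h ?h"
    using \<psi>_gap[OF z_mem, of k ?k] by (simp add: blinfun.diff_right algebra_simps)
  \<comment> \<open>Both points contain the same multiple of \<open>y k\<close>, so only the
    displacement from \<open>z k\<close> to \<open>xhat\<close>, scaled by \<open>\<tau> k\<close>,
    remains.\<close>
  have wx: "?w - ?x = ?t *\<^sub>R (?h - z k)" by (simp add: run_w run_x algebra_simps)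
  then have norm_wx: "norm (?w - ?x) = ?t * norm (?h - z k)" using \<tau>_bounds by simp
  \<comment> \<open>As \<open>\<tau> k\<close> is the quotient of \<open>\<alpha>\<close> and
    \<open>B\<close>, the weight becomes \<open>\<alpha>\<^sup>2 * \<beta> / B\<close>, which
    \<open>step_cond\<close> bounds by \<open>\<beta> k\<close>.\<close>
  have "?B * (\<beta> ?k / 2 * (norm (?w - ?x))\<^sup>2) = (?\<alpha>\<^sup>2 * \<beta> ?k) / ?B * (1 / 2 * (norm (?h - z k))\<^sup>2)"
    using B_pos[of ?k] unfolding norm_wx \<alpha>
    by (simp add: power_mult_distrib field_simps power2_eq_square)
  also have "\<dots> \<le> \<beta> k * (1 / 2 * (norm (?h - z k))\<^sup>2)"
    using step_cond[of k] B_pos[of ?k] by (intro mult_right_mono) (auto simp: divide_le_eq mult.commute)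
  also have "\<dots> \<le> \<beta> k * bregman d grad_d ?h (z k)"
    using \<beta>_pos[of k] by (intro mult_left_mono bregman_ge xhat_mem z_mem) auto
  finally have 2: "?B * (\<beta> ?k / 2 * (norm (?w - ?x))\<^sup>2) \<le> \<beta> k * bregman d grad_d ?h (z k)" .
  have 3: "?B * f ?w \<le> ?B * (?f + ?\<gamma> (?w - ?x) + \<beta> ?k / 2 * (norm (?w - ?x))\<^sup>2 + \<delta>
      + (norm (\<eta> ?k))\<^sup>2 / (2 * (\<beta> ?k - L)))"
    using B_pos[of ?k] f_upper[OF w_mem \<eta>] by (intro mult_left_mono) auto
  have 4: "(?B - ?\<alpha>) * (?f + g\<^sub>o ?x (y k - ?x)) \<le> (?B - ?\<alpha>) * f (y k)"
    using \<alpha>_le_B[of ?k] by (intro mult_left_mono f_lower y_mem) auto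
  have "h ?w \<le> ?t * h ?h + (1 - ?t) * h (y k)"
    unfolding run_w using convex_onD[OF h, of "1 - ?t" ?h "y k"] \<tau>_bounds xhat_mem y_mem by simp
  then have 5: "?B * h ?w \<le> ?B * (?t * h ?h + (1 - ?t) * h (y k))"
    using B_pos[of ?k] by (intro mult_left_mono) auto
  define \<theta> where "\<theta> = B ?k / A ?k"
  have \<theta>: "0 \<le> \<theta>" "\<theta> \<le> 1" "A ?k * \<theta> = ?B" using BA_bounds[of ?k] A_pos[of ?k] by (auto simp: \<theta>_def)
  have "convex_on Q \<phi>" unfolding \<phi>_def[abs_def] using f h by (rule convex_on_add)
  then have "\<phi> (y ?k) \<le> \<theta> * \<phi> ?w + (1 - \<theta>) * \<phi> (y k)"
    unfolding run_y' \<theta>_def[symmetric]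
    using convex_onD[of Q \<phi> "1 - \<theta>" ?w "y k"] \<theta> w_mem y_mem by simp
  then have "A ?k * \<phi> (y ?k) \<le> A ?k * (\<theta> * \<phi> ?w + (1 - \<theta>) * \<phi> (y k))"
    using A_pos[of ?k] by (intro mult_left_mono) auto
  also have "\<dots> = (A ?k * \<theta>) * \<phi> ?w + (A ?k - A ?k * \<theta>) * \<phi> (y k)" by (simp add: algebra_simps)
  finally have 6: "A ?k * \<phi> (y ?k) \<le> ?B * \<phi> ?w + (A ?k - ?B) * \<phi> (y k)" by (simp add: \<theta>)
  \<comment> \<open>The gradient term of weight \<open>B\<close> splits into the model's share at
    \<open>xhat\<close> and the excess at \<open>y k\<close>.\<close>
  have 7: "?\<gamma> (?w - ?x) * ?B = ?\<alpha> * ?\<gamma> (?h - ?x) + (?B - ?\<alpha>) * ?\<gamma> (y k - ?x)"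
    unfolding run_w \<alpha> by (simp add: blinfun.diff_right blinfun.add_right blinfun.scaleR_right algebra_simps)
  have 8: "\<eta> ?k (y k - ?x) = ?\<gamma> (y k - ?x) - g\<^sub>o ?x (y k - ?x)"
    by (simp add: \<eta>_def blinfun.diff_left)
  have 9: "Er ?k = Er k + (?B * \<delta> + ?B * (norm (\<eta> ?k))\<^sup>2 / (2 * (\<beta> ?k - L))
    + (?B - ?\<alpha>) * \<eta> ?k (y k - ?x))"
    by (simp add: Er_def)
  define H where "H = (norm (\<eta> ?k))\<^sup>2 / (2 * (\<beta> ?k - L))"
  have H: "?B * (norm (\<eta> ?k))\<^sup>2 / (2 * (\<beta> ?k - L)) = ?B * H" by (simp add: H_def)
  have h_w: "?B * h ?w \<le> ?\<alpha> * h ?h + (?B - ?\<alpha>) * h (y k)"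
    using 5 unfolding \<alpha> by (simp add: algebra_simps)
  \<comment> \<open>The remaining products are turned into atoms, so that the conclusion is a linear
    combination of the collected facts.\<close>
  define N where "N = \<beta> ?k / 2 * (norm (?w - ?x))\<^sup>2"
  define c where "c = ?B - ?\<alpha>"
  have e1: "\<psi> k (z k) + \<beta> k * bregman d grad_d ?h (z k) + ?\<alpha> * ?f + ?\<alpha> * ?\<gamma> (?h - ?x) + ?\<alpha> * h ?h
      \<le> \<psi> ?k (z ?k)"
    using 1 by (simp only: distrib_left)
  have e3: "?B * f ?w \<le> ?B * ?f + ?\<gamma> (?w - ?x) * ?B + ?B * N + ?B * \<delta> + ?B * H"
    using 3 unfolding N_def[symmetric] H_def[symmetric] by (simp only: distrib_left mult.commute)
  have e4: "?B * ?f - ?\<alpha> * ?f + c * g\<^sub>o ?x (y k - ?x) \<le> c * f (y k)"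
    using 4 by (simp only: distrib_left c_def[symmetric]) (simp only: c_def left_diff_distrib)
  have e6: "A ?k * \<phi> (y ?k) \<le> ?B * f ?w + ?B * h ?w + A k * \<phi> (y k) - c * f (y k) - c * h (y k)"
    using 6 by (simp add: \<phi>_def A c_def algebra_simps)
  have e8: "c * \<eta> ?k (y k - ?x) = c * ?\<gamma> (y k - ?x) - c * g\<^sub>o ?x (y k - ?x)"
    unfolding 8 by (rule right_diff_distrib)
  show ?thesis
    using e1 2 e3 e4 h_w e6 7 IH e8 9
    unfolding c_def[symmetric] N_def[symmetric] H by linarith
qed

lemma \<psi>_lower:
  assumes "\<And>i. i \<le> k \<Longrightarrow> \<beta> i = L \<Longrightarrow> \<eta> i = 0"
  shows "A k * \<phi> (y k) \<le> \<psi> k (z k) + Er k"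
  using assms by (induction k) (auto intro: \<psi>_lower_0 \<psi>_lower_Suc)

text \<open>The minimum of the model is at most its value at \<open>xs\<close>, which the lower
  oracle bound compares with \<open>\<phi> xs\<close>. That bound uses the true gradients, so it
  releases noise paired with \<open>xs - x i\<close>; together with the linear part of
  \<open>Er\<close> this forms \<open>v\<close>.\<close>

theorem path_bound:
  assumes "\<And>i. i \<le> k \<Longrightarrow> \<beta> i = L \<Longrightarrow> \<eta> i = 0" and xs: "xs \<in> Q"
  shows "A k * (\<phi> (y k) - \<phi> xs) \<le> \<beta> k * d xs
    + (\<Sum>i\<le>k. B i * \<delta> + B i * (norm (\<eta> i))\<^sup>2 / (2 * (\<beta> i - L)) + \<eta> i (v xs i))"
proof -
  have "\<psi> k (z k) \<le> \<psi> k xs" using z_arg_min_\<psi>[of k] xs by (simp add: is_arg_min_linorder)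
  also have "\<dots> \<le> \<beta> k * d xs + (\<Sum>i\<le>k. \<alpha> i * f xs + \<alpha> i * \<eta> i (xs - x i)) + A k * h xs"
    unfolding \<psi>_def
  proof (intro add_mono sum_mono order_refl)
    fix i
    have "\<alpha> i * (f\<^sub>o (x i) + g\<^sub>o (x i) (xs - x i)) \<le> \<alpha> i * f xs"
      using \<alpha>_pos[of i] f_lower[OF xs, of i] by simp
    then show "\<alpha> i * (f\<^sub>o (x i) + \<gamma> i (xs - x i)) \<le> \<alpha> i * f xs + \<alpha> i * \<eta> i (xs - x i)"
      by (simp add: \<eta>_def blinfun.diff_left algebra_simps)
  qed
  also have "(\<Sum>i\<le>k. \<alpha> i * f xs + \<alpha> i * \<eta> i (xs - x i))
      = A k * f xs + (\<Sum>i\<le>k. \<alpha> i * \<eta> i (xs - x i))"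
    by (simp add: A_def sum.distrib sum_distrib_right)
  finally have "A k * \<phi> (y k) - A k * \<phi> xs \<le> \<beta> k * d xs + (\<Sum>i\<le>k. \<alpha> i * \<eta> i (xs - x i)) + Er k"
    using \<psi>_lower[of k, OF assms(1)] by (simp add: \<phi>_def distrib_left)
  also have "\<dots> = \<beta> k * d xs
    + (\<Sum>i\<le>k. B i * \<delta> + B i * (norm (\<eta> i))\<^sup>2 / (2 * (\<beta> i - L)) + \<eta> i (v xs i))"
    unfolding Er_def v_def sum.distrib[symmetric] add.assoc
    by (simp add: sum.distrib blinfun.add_right blinfun.scaleR_right)
  finally show ?thesis by (simp add: algebra_simps)
qed

end

section \<open>Fresh draws and expectations\<close>

text \<open>Pushing \<open>K x\<close> forward by \<open>Pair x\<close> removes \<open>x\<close>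
  from the integrand: a fixed function is integrated against a measurable kernel on the
  product.\<close>

lemma integral_measurable_kernel:
  fixes f :: "'a \<Rightarrow> 'b \<Rightarrow> real"
  assumes f: "(\<lambda>(x, s). f x s) \<in> borel_measurable (N \<Otimes>\<^sub>M S)"
    and K: "K \<in> N \<rightarrow>\<^sub>M subprob_algebra S"
  shows "(\<lambda>x. \<integral>s. f x s \<partial>K x) \<in> borel_measurable N"
proof -
  note [measurable] = f K
  have "(\<lambda>x. distr (K x) (N \<Otimes>\<^sub>M S) (Pair x)) \<in> N \<rightarrow>\<^sub>M subprob_algebra (N \<Otimes>\<^sub>M S)"
    by (rule measurable_distr2) measurable
  from measurable_compose[OF this integral_measurable_subprob_algebra[OF f]]
  have "(\<lambda>x. \<integral>p. (case p of (x, s) \<Rightarrow> f x s) \<partial>distr (K x) (N \<Otimes>\<^sub>M S) (Pair x)) \<in> borel_measurable N" .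
  moreover have "(\<integral>p. (case p of (x, s) \<Rightarrow> f x s) \<partial>distr (K x) (N \<Otimes>\<^sub>M S) (Pair x)) = (\<integral>s. f x s \<partial>K x)"
    if "x \<in> space N" for x
  proof -
    have [measurable_cong]: "sets (K x) = sets S" using sets_kernel[OF K that] .
    show ?thesis using that by (subst integral_distr) auto
  qed
  ultimately show ?thesis by (simp cong: measurable_cong)
qed

text \<open>A disintegration. The null set in \<open>fresh\<close> depends on \<open>C\<close>, so
  both sides are compared on rectangles, where conditional expectation applies; rectangles determine
  a finite measure. The past is encoded by equipping the whole outcome \<open>\<omega>\<close> with
  the smaller sigma-algebra \<open>P\<close>.\<close>

lemma (in prob_space) distr_fresh_draw:
  assumes P: "subalgebra M P" and \<xi>[measurable]: "\<xi> \<in> M \<rightarrow>\<^sub>M S"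
    and K: "K \<in> P \<rightarrow>\<^sub>M prob_algebra S"
    and fresh: "\<And>C. C \<in> sets S \<Longrightarrow>
      AE \<omega> in M. real_cond_exp M P (\<lambda>\<omega>. indicator C (\<xi> \<omega>)) \<omega> = measure (K \<omega>) C"
  shows "distr M (P \<Otimes>\<^sub>M S) (\<lambda>\<omega>. (\<omega>, \<xi> \<omega>))
    = restr_to_subalg M P \<bind> (\<lambda>\<omega>. distr (K \<omega>) (P \<Otimes>\<^sub>M S) (Pair \<omega>))" (is "?D1 = ?D2")
proof -
  interpret finite_measure_subalgebra M P by unfold_locales (rule P)
  let ?N = "restr_to_subalg M P"
  have setsN[measurable_cong]: "sets ?N = sets P" by (rule sets_restr_to_subalg[OF P])
  have spP: "space P = space M" and setsP: "sets P \<subseteq> sets M" using P by (auto simp: subalgebra_def)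
  have id[measurable]: "(\<lambda>\<omega>. \<omega>) \<in> M \<rightarrow>\<^sub>M P"
    using setsP spP by (auto simp: measurable_def)
  note [measurable] = measurable_prob_algebraD[OF K]
  have kernel: "(\<lambda>\<omega>. distr (K \<omega>) (P \<Otimes>\<^sub>M S) (Pair \<omega>)) \<in> ?N \<rightarrow>\<^sub>M subprob_algebra (P \<Otimes>\<^sub>M S)"
    unfolding measurable_cong_sets[OF setsN refl]
    by (rule measurable_distr2[OF _ measurable_prob_algebraD[OF K]]) simp
  have ne: "space ?N \<noteq> {}" using not_empty by (simp add: space_restr_to_subalg)
  let ?E = "{a \<times> b |a b. a \<in> sets P \<and> b \<in> sets S}"
  show ?thesis
  proof (rule measure_eqI_generator_eq[OF Int_stable_pair_measure_generator[of P S]])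
    show "?E \<subseteq> Pow (space P \<times> space S)"
      using sets.space_closed[of P] sets.space_closed[of S] by auto
    show "sets ?D1 = sigma_sets (space P \<times> space S) ?E" by (simp add: sets_pair_measure)
    show "sets ?D2 = sigma_sets (space P \<times> space S) ?E"
      by (subst sets_bind[OF _ ne, of _ "P \<Otimes>\<^sub>M S"]) (simp_all add: sets_pair_measure)
    show "range (\<lambda>_::nat. space P \<times> space S) \<subseteq> ?E" by auto
    show "(\<Union>i::nat. space P \<times> space S) = space P \<times> space S" by simp
    show "emeasure ?D1 (space P \<times> space S) \<noteq> \<infinity>"
    proof -
      interpret D: prob_space ?D1 by (rule prob_space_distr) measurable
      show ?thesis using D.emeasure_finite by simp
    qed
    fix X assume "X \<in> ?E"
    then obtain A C where X: "X = A \<times> C" and A: "A \<in> sets P" and C[measurable]: "C \<in> sets S" by auto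
    have AM[measurable]: "A \<in> sets M" using A setsP by auto
    note A[measurable]
    have int: "integrable M (\<lambda>\<omega>. indicator A \<omega> * indicator C (\<xi> \<omega>) :: real)"
      by (rule integrable_const_bound[where B=1]) (auto simp: indicator_def)
    have "emeasure ?D1 X = emeasure M (A \<inter> \<xi> -` C \<inter> space M)"
      unfolding X by (subst emeasure_distr) (auto intro!: arg_cong2[where f=emeasure])
    also have "\<dots> = (\<integral>\<^sup>+\<omega>. ennreal (indicator A \<omega> * indicator C (\<xi> \<omega>)) \<partial>M)"
    proof -
      have "A \<inter> \<xi> -` C \<inter> space M \<in> sets M" by measurable
      from nn_integral_indicator[OF this, symmetric] show ?thesis
        by (simp only:) (rule nn_integral_cong, auto simp: indicator_def)
    qed
    also have "\<dots> = ennreal (\<integral>\<omega>. indicator A \<omega> * indicator C (\<xi> \<omega>) \<partial>M)"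
      by (rule nn_integral_eq_integral[OF int]) simp
    \<comment> \<open>\<open>indicator A\<close> is measurable in the past, so the indicator of the
      draw may be replaced by its conditional expectation.\<close>
    also have "(\<integral>\<omega>. indicator A \<omega> * indicator C (\<xi> \<omega>) \<partial>M)
        = (\<integral>\<omega>. indicator A \<omega> * real_cond_exp M P (\<lambda>\<omega>. indicator C (\<xi> \<omega>)) \<omega> \<partial>M)"
      by (rule real_cond_exp_intg(2)[symmetric, OF int]) measurable
    also have "\<dots> = (\<integral>\<omega>. indicator A \<omega> * measure (K \<omega>) C \<partial>M)"
    proof (rule integral_cong_AE)
      show "(\<lambda>\<omega>. indicator A \<omega> * measure (K \<omega>) C) \<in> borel_measurable M"
        by (rule measurable_compose[OF id]) measurable
      show "AE \<omega> in M. indicator A \<omega> * real_cond_exp M P (\<lambda>\<omega>. indicator C (\<xi> \<omega>)) \<omega>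
          = indicator A \<omega> * measure (K \<omega>) C"
        using fresh[OF C] by eventually_elim simp
    qed measurable
    also have "ennreal \<dots> = (\<integral>\<^sup>+\<omega>. ennreal (indicator A \<omega> * measure (K \<omega>) C) \<partial>M)"
    proof (rule nn_integral_eq_integral[symmetric])
      show "integrable M (\<lambda>\<omega>. indicator A \<omega> * measure (K \<omega>) C)"
      proof (rule integrable_const_bound[where B=1])
        show "(\<lambda>\<omega>. indicator A \<omega> * measure (K \<omega>) C) \<in> borel_measurable M"
          by (rule measurable_compose[OF id]) measurable
        show "AE \<omega> in M. norm (indicator A \<omega> * measure (K \<omega>) C) \<le> 1"
        proof (rule AE_I2)
          fix \<omega> assume "\<omega> \<in> space M"
          then interpret K: prob_space "K \<omega>"
            using measurable_space[OF K, of \<omega>] spP by (auto simp: space_prob_algebra)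
          show "norm (indicator A \<omega> * measure (K \<omega>) C) \<le> 1" by (simp add: indicator_def)
        qed
      qed
    qed simp
    also have "\<dots> = (\<integral>\<^sup>+\<omega>. ennreal (indicator A \<omega> * measure (K \<omega>) C) \<partial>?N)"
      by (rule nn_integral_subalgebra2[symmetric, OF P]) measurable
    also have "\<dots> = (\<integral>\<^sup>+\<omega>. emeasure (distr (K \<omega>) (P \<Otimes>\<^sub>M S) (Pair \<omega>)) X \<partial>?N)"
    proof (rule nn_integral_cong)
      fix \<omega> assume "\<omega> \<in> space ?N"
      then have \<omega>: "\<omega> \<in> space P" by (simp add: space_restr_to_subalg spP)
      then interpret K: prob_space "K \<omega>"
        using measurable_space[OF K, of \<omega>] by (auto simp: space_prob_algebra)
      have [measurable_cong]: "sets (K \<omega>) = sets S"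
        using measurable_space[OF K \<omega>] by (simp add: space_prob_algebra)
      have "emeasure (distr (K \<omega>) (P \<Otimes>\<^sub>M S) (Pair \<omega>)) X = emeasure (K \<omega>) (Pair \<omega> -` X \<inter> space (K \<omega>))"
        unfolding X using \<omega> by (intro emeasure_distr) auto
      also have "Pair \<omega> -` X \<inter> space (K \<omega>) = (if \<omega> \<in> A then C else {})"
        using sets.sets_into_space[OF C] sets_eq_imp_space_eq[of "K \<omega>" S]
        by (auto simp: X \<open>sets (K \<omega>) = sets S\<close>)
      finally show "ennreal (indicator A \<omega> * measure (K \<omega>) C)
          = emeasure (distr (K \<omega>) (P \<Otimes>\<^sub>M S) (Pair \<omega>)) X"
        by (simp add: K.emeasure_eq_measure)
    qed
    also have "\<dots> = emeasure ?D2 X"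
      by (rule emeasure_bind[symmetric, OF ne kernel]) (simp add: X)
    finally show "emeasure ?D1 X = emeasure ?D2 X" .
  qed
qed

text \<open>The disintegration in Tonelli form. Nonnegative integrals avoid any integrability
  question about the iterates.\<close>

lemma (in prob_space) nn_integral_fresh_draw:
  assumes P: "subalgebra M P" and \<xi>[measurable]: "\<xi> \<in> M \<rightarrow>\<^sub>M S"
    and K: "K \<in> P \<rightarrow>\<^sub>M prob_algebra S"
    and fresh: "\<And>C. C \<in> sets S \<Longrightarrow>
      AE \<omega> in M. real_cond_exp M P (\<lambda>\<omega>. indicator C (\<xi> \<omega>)) \<omega> = measure (K \<omega>) C"
    and \<Phi>: "(\<lambda>(\<omega>, s). \<Phi> \<omega> s) \<in> borel_measurable (P \<Otimes>\<^sub>M S)"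
  shows "(\<integral>\<^sup>+\<omega>. \<Phi> \<omega> (\<xi> \<omega>) \<partial>M) = (\<integral>\<^sup>+\<omega>. (\<integral>\<^sup>+s. \<Phi> \<omega> s \<partial>K \<omega>) \<partial>M)"
proof -
  let ?N = "restr_to_subalg M P"
  have setsN[measurable_cong]: "sets ?N = sets P" by (rule sets_restr_to_subalg[OF P])
  have [measurable]: "(\<lambda>\<omega>. \<omega>) \<in> M \<rightarrow>\<^sub>M P"
    using P by (auto simp: measurable_def subalgebra_def)
  note [measurable] = measurable_prob_algebraD[OF K] \<Phi>
  have kernel: "(\<lambda>\<omega>. distr (K \<omega>) (P \<Otimes>\<^sub>M S) (Pair \<omega>)) \<in> ?N \<rightarrow>\<^sub>M subprob_algebra (P \<Otimes>\<^sub>M S)"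
    unfolding measurable_cong_sets[OF setsN refl]
    by (rule measurable_distr2[OF _ measurable_prob_algebraD[OF K]]) simp
  have "(\<integral>\<^sup>+\<omega>. \<Phi> \<omega> (\<xi> \<omega>) \<partial>M)
      = (\<integral>\<^sup>+p. (case p of (\<omega>, s) \<Rightarrow> \<Phi> \<omega> s) \<partial>distr M (P \<Otimes>\<^sub>M S) (\<lambda>\<omega>. (\<omega>, \<xi> \<omega>)))"
    by (subst nn_integral_distr) auto
  also have "\<dots> = (\<integral>\<^sup>+\<omega>. \<integral>\<^sup>+p. (case p of (\<omega>, s) \<Rightarrow> \<Phi> \<omega> s) \<partial>distr (K \<omega>) (P \<Otimes>\<^sub>M S) (Pair \<omega>) \<partial>?N)"
    by (subst distr_fresh_draw[OF P \<xi> K fresh], assumption) (rule nn_integral_bind[OF \<Phi> kernel])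
  also have "\<dots> = (\<integral>\<^sup>+\<omega>. (\<integral>\<^sup>+s. \<Phi> \<omega> s \<partial>K \<omega>) \<partial>?N)"
  proof (rule nn_integral_cong)
    fix \<omega> assume "\<omega> \<in> space ?N"
    then have \<omega>: "\<omega> \<in> space P" using P by (simp add: space_restr_to_subalg subalgebra_def)
    have [measurable_cong]: "sets (K \<omega>) = sets S"
      using measurable_space[OF K \<omega>] by (simp add: space_prob_algebra)
    show "(\<integral>\<^sup>+p. (case p of (\<omega>, s) \<Rightarrow> \<Phi> \<omega> s) \<partial>distr (K \<omega>) (P \<Otimes>\<^sub>M S) (Pair \<omega>))
        = (\<integral>\<^sup>+s. \<Phi> \<omega> s \<partial>K \<omega>)"
      using \<omega> by (subst nn_integral_distr) auto
  qed
  also have "\<dots> = (\<integral>\<^sup>+\<omega>. (\<integral>\<^sup>+s. \<Phi> \<omega> s \<partial>K \<omega>) \<partial>M)"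
    by (rule nn_integral_subalgebra2[OF P]) (rule nn_integral_measurable_subprob_algebra2; measurable)
  finally show ?thesis .
qed

text \<open>The negative part has integral 0 along the run, hence also after integrating over a draw
  with frozen past. A sign known on actual runs thus passes to almost every value of the
  draw.\<close>

lemma (in prob_space) AE_fresh_draw:
  assumes P: "subalgebra M P" and \<xi>[measurable]: "\<xi> \<in> M \<rightarrow>\<^sub>M S"
    and K: "K \<in> P \<rightarrow>\<^sub>M prob_algebra S"
    and fresh: "\<And>C. C \<in> sets S \<Longrightarrow>
      AE \<omega> in M. real_cond_exp M P (\<lambda>\<omega>. indicator C (\<xi> \<omega>)) \<omega> = measure (K \<omega>) C"
    and g[measurable]: "(\<lambda>(\<omega>, s). g \<omega> s) \<in> borel_measurable (P \<Otimes>\<^sub>M S)"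
    and nonneg: "AE \<omega> in M. (0::real) \<le> g \<omega> (\<xi> \<omega>)"
  shows "AE \<omega> in M. AE s in K \<omega>. 0 \<le> g \<omega> s"
proof -
  note Km[measurable] = measurable_prob_algebraD[OF K]
  have idm: "(\<lambda>\<omega>. \<omega>) \<in> M \<rightarrow>\<^sub>M P" using P by (auto simp: measurable_def subalgebra_def)
  have neg: "(\<lambda>(\<omega>, s). ennreal (- g \<omega> s)) \<in> borel_measurable (P \<Otimes>\<^sub>M S)"
    using g by measurable
  have "(\<integral>\<^sup>+\<omega>. (\<integral>\<^sup>+s. ennreal (- g \<omega> s) \<partial>K \<omega>) \<partial>M) = (\<integral>\<^sup>+\<omega>. ennreal (- g \<omega> (\<xi> \<omega>)) \<partial>M)"
    by (rule nn_integral_fresh_draw[symmetric, OF P \<xi> K fresh neg])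
  also have "\<dots> = (\<integral>\<^sup>+\<omega>. 0 \<partial>M)"
    by (rule nn_integral_cong_AE) (use nonneg in \<open>auto simp: ennreal_neg\<close>)
  finally have zero: "(\<integral>\<^sup>+\<omega>. (\<integral>\<^sup>+s. ennreal (- g \<omega> s) \<partial>K \<omega>) \<partial>M) = 0" by simp
  have "(\<lambda>\<omega>. \<integral>\<^sup>+s. ennreal (- g \<omega> s) \<partial>K \<omega>) \<in> borel_measurable P"
    by (rule nn_integral_measurable_subprob_algebra2[OF neg Km])
  from measurable_compose[OF idm this]
  have "(\<lambda>\<omega>. \<integral>\<^sup>+s. ennreal (- g \<omega> s) \<partial>K \<omega>) \<in> borel_measurable M" .
  then have "AE \<omega> in M. (\<integral>\<^sup>+s. ennreal (- g \<omega> s) \<partial>K \<omega>) = 0"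
    using zero by (simp add: nn_integral_0_iff_AE)
  then show ?thesis
  proof (rule AE_mp[OF _ AE_I2], intro impI)
    fix \<omega> assume \<omega>: "\<omega> \<in> space M" and z: "(\<integral>\<^sup>+s. ennreal (- g \<omega> s) \<partial>K \<omega>) = 0"
    have \<omega>P: "\<omega> \<in> space P" using \<omega> P by (simp add: subalgebra_def)
    have setsK: "sets (K \<omega>) = sets S"
      using measurable_space[OF K \<omega>P] by (simp add: space_prob_algebra)
    have "(\<lambda>s. ennreal (- g \<omega> s)) \<in> borel_measurable (K \<omega>)"
      unfolding measurable_cong_sets[OF setsK refl] using measurable_Pair2[OF neg \<omega>P] by simp
    then have "AE s in K \<omega>. ennreal (- g \<omega> s) = 0"
      using z by (simp add: nn_integral_0_iff_AE)
    then show "AE s in K \<omega>. 0 \<le> g \<omega> s" by eventually_elim (simp add: ennreal_eq_0_iff)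
  qed
qed

lemma space_past[simp]: "space (past M S \<xi> i) = space M"
  by (simp add: past_def)

text \<open>Taken with \<open>N = M\<close> it places the past inside \<open>M\<close>; with a later
  past as \<open>N\<close> it shows that the pasts increase.\<close>

lemma measurable_past_ident:
  assumes "space N = space M" and "\<And>j. j < i \<Longrightarrow> \<xi> j \<in> N \<rightarrow>\<^sub>M S"
  shows "(\<lambda>\<omega>. \<omega>) \<in> N \<rightarrow>\<^sub>M past M S \<xi> i"
  unfolding past_def
  by (rule measurable_vimage_algebra2) (use assms in \<open>auto intro!: measurable_restrict\<close>)

text \<open>\<open>obj_meas\<close> does not follow from measurability of \<open>y k\<close>: a
  convex function on a closed set can fail to be Borel on the boundary. \<open>\<beta>_eq_L\<close>
  confines vanishing denominators to the noiseless case.\<close>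

locale stochastic_sigm = prob_space M + prox_setup Q d grad_d x0
  for M :: "'w measure" and Q :: "'e::real_normed_vector set" and d grad_d x0 +
  fixes f h :: "'e \<Rightarrow> real" and f\<^sub>o g\<^sub>o and L \<delta> \<sigma> :: real and \<alpha> \<beta> B :: "nat \<Rightarrow> real"
    and S :: "'s measure" and \<mu> F G and \<xi> :: "nat \<Rightarrow> 'w \<Rightarrow> 's"
    and x y z xhat w :: "nat \<Rightarrow> 'w \<Rightarrow> 'e" and xs :: 'e
  assumes fd: "finite_dim TYPE('e)"
    and f: "convex_on Q f" and h: "convex_on Q h"
    and inexact: "inexact_oracle Q f \<delta> L f\<^sub>o g\<^sub>o"
    and stochastic: "stochastic_oracle Q S \<mu> \<sigma> f\<^sub>o g\<^sub>o F G"
    and L_pos: "L > 0" and \<delta>_nonneg: "\<delta> \<ge> 0"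
    and \<alpha>_pos: "\<And>i. \<alpha> i > 0" and \<alpha>_0: "\<alpha> 0 \<le> 1" and B_0: "B 0 = \<alpha> 0"
    and \<alpha>_le_B: "\<And>i. \<alpha> i \<le> B i" and B_le_A: "\<And>i. B i \<le> (\<Sum>j\<le>i. \<alpha> j)"
    and \<beta>_ge: "\<And>i. L \<le> \<beta> i" and \<beta>_mono: "\<And>i. \<beta> i \<le> \<beta> (Suc i)"
    and step_cond: "\<And>i. (\<alpha> (Suc i))\<^sup>2 * \<beta> (Suc i) \<le> B (Suc i) * \<beta> i"
    and \<beta>_eq_L: "\<And>i. \<beta> i = L \<Longrightarrow> \<sigma> = 0"
    and fresh: "fresh_draws M S \<mu> x \<xi>"
    and run: "\<And>\<omega>. \<omega> \<in> space M \<Longrightarrow>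
           SIGM Q h d grad_d \<alpha> \<beta> B (\<lambda>i. G (x i \<omega>) (\<xi> i \<omega>))
             (\<lambda>i. x i \<omega>) (\<lambda>i. y i \<omega>) (\<lambda>i. z i \<omega>) (\<lambda>i. xhat i \<omega>) (\<lambda>i. w i \<omega>)"
    and xs: "is_arg_min (\<lambda>u. f u + h u) (\<lambda>u. u \<in> Q) xs"
    and obj_meas: "\<And>k. (\<lambda>\<omega>. f (y k \<omega>) + h (y k \<omega>)) \<in> borel_measurable M"
begin

abbreviation "P i \<equiv> past M S \<xi> i"

definition "\<gamma> i \<omega> = G (x i \<omega>) (\<xi> i \<omega>)"
definition "\<eta> i \<omega> = \<gamma> i \<omega> - g\<^sub>o (x i \<omega>)"
definition "v i \<omega> = \<alpha> i *\<^sub>R (xs - x i \<omega>)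
  + (B i - \<alpha> i) *\<^sub>R ((if i = 0 then x 0 \<omega> else y (i - 1) \<omega>) - x i \<omega>)"
definition "C i = B i / (2 * (\<beta> i - L))"
definition "Y k \<omega> = \<beta> k * d xs + (\<Sum>i\<le>k. B i * \<delta> + C i * (norm (\<eta> i \<omega>))\<^sup>2 + \<eta> i \<omega> (v i \<omega>))"

lemma path: "\<omega> \<in> space M \<Longrightarrow> sigm_run Q d grad_d x0 f h f\<^sub>o g\<^sub>o L \<delta> \<alpha> \<beta> B
  (\<lambda>i. \<gamma> i \<omega>) (\<lambda>i. x i \<omega>) (\<lambda>i. y i \<omega>) (\<lambda>i. z i \<omega>) (\<lambda>i. xhat i \<omega>) (\<lambda>i. w i \<omega>)"
  unfolding \<gamma>_def
  by unfold_locales (rule f h inexact L_pos \<alpha>_pos \<alpha>_0 B_0 \<alpha>_le_B B_le_A \<beta>_ge \<beta>_mono step_cond run | assumption)+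

lemma xs_mem: "xs \<in> Q" and xs_min: "u \<in> Q \<Longrightarrow> f xs + h xs \<le> f u + h u"
  using xs by (auto simp: is_arg_min_linorder)

lemma A_pos: "(\<Sum>j\<le>k. \<alpha> j) > 0" by (intro sum_pos) (auto simp: \<alpha>_pos)
lemma \<beta>_pos: "\<beta> i > 0" using \<beta>_ge[of i] L_pos by simp
lemma B_pos: "B i > 0" using \<alpha>_pos[of i] \<alpha>_le_B[of i] by simp
lemma C_nonneg: "C i \<ge> 0" using B_pos[of i] \<beta>_ge[of i] by (simp add: C_def)

lemma path_inequality:
  assumes \<omega>: "\<omega> \<in> space M" and "\<And>i. i \<le> k \<Longrightarrow> \<beta> i = L \<Longrightarrow> \<eta> i \<omega> = 0"
  shows "(\<Sum>j\<le>k. \<alpha> j) * ((f (y k \<omega>) + h (y k \<omega>)) - (f xs + h xs)) \<le> Y k \<omega>"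
proof -
  interpret r: sigm_run Q d grad_d x0 f h f\<^sub>o g\<^sub>o L \<delta> \<alpha> \<beta> B
    "\<lambda>i. \<gamma> i \<omega>" "\<lambda>i. x i \<omega>" "\<lambda>i. y i \<omega>" "\<lambda>i. z i \<omega>" "\<lambda>i. xhat i \<omega>" "\<lambda>i. w i \<omega>"
    by (rule path[OF \<omega>])
  have \<eta>: "r.\<eta> i = \<eta> i \<omega>" for i by (simp add: r.\<eta>_def \<eta>_def)
  have v: "r.v xs i = v i \<omega>" for i by (simp add: r.v_def v_def)
  show ?thesis
    using r.path_bound[of k xs] assms(2) xs_mem
    by (simp add: \<eta> v r.A_def r.\<phi>_def Y_def C_def)
qed

lemma mem: "\<omega> \<in> space M \<Longrightarrow> x k \<omega> \<in> Q" "\<omega> \<in> space M \<Longrightarrow> y k \<omega> \<in> Q" "\<omega> \<in> space M \<Longrightarrow> z k \<omega> \<in> Q"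
  using sigm_run.x_mem[OF path] sigm_run.y_mem[OF path] sigm_run.z_mem[OF path] by blast+

lemma \<xi>_meas: "\<xi> i \<in> M \<rightarrow>\<^sub>M S"
  using fresh by (simp add: fresh_draws_def)

lemma draw: "E \<in> sets S \<Longrightarrow>
    AE \<omega> in M. real_cond_exp M (P i) (\<lambda>\<omega>. indicator E (\<xi> i \<omega>)) \<omega> = measure (\<mu> (x i \<omega>)) E"
  using fresh by (simp add: fresh_draws_def)

lemma past_sub: "subalgebra M (P i)"
proof -
  have "(\<lambda>\<omega>. \<omega>) \<in> M \<rightarrow>\<^sub>M P i"
    by (rule measurable_past_ident) (auto simp: \<xi>_meas)
  from measurable_sets[OF this] show ?thesis
    using sets.sets_into_space[of _ "P i"] by (auto simp: subalgebra_def Int_absorb2)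
qed

lemma \<xi>_past: "j < i \<Longrightarrow> \<xi> j \<in> P i \<rightarrow>\<^sub>M S"
proof -
  assume j: "j < i"
  have "(\<lambda>\<omega>. \<lambda>j\<in>{..<i}. \<xi> j \<omega>) \<in> P i \<rightarrow>\<^sub>M (\<Pi>\<^sub>M j\<in>{..<i}. S)"
    unfolding past_def
    by (rule measurable_vimage_algebra1)
      (auto simp: space_PiM intro: measurable_space[OF \<xi>_meas] split: if_splits)
  from measurable_compose[OF this measurable_component_singleton[of j]] j
  show ?thesis by simp
qed

lemma past_mono:
  assumes "i \<le> j" "X \<in> P i \<rightarrow>\<^sub>M N"
  shows "X \<in> P j \<rightarrow>\<^sub>M N"
proof -
  have "(\<lambda>\<omega>. \<omega>) \<in> P j \<rightarrow>\<^sub>M P i"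
    by (rule measurable_past_ident) (use assms in \<open>auto intro!: \<xi>_past\<close>)
  from measurable_compose[OF this assms(2)] show ?thesis .
qed

lemma past_cong:
  "\<lbrakk>\<And>\<omega>. \<omega> \<in> space M \<Longrightarrow> X \<omega> = X' \<omega>; X' \<in> P i \<rightarrow>\<^sub>M N\<rbrakk> \<Longrightarrow> X \<in> P i \<rightarrow>\<^sub>M N"
  by (subst measurable_cong[of _ X X']) simp_all

section \<open>Measurability of the oracle and of the iterates\<close>

lemma \<mu>_meas: "\<mu> \<in> restrict_space borel Q \<rightarrow>\<^sub>M prob_algebra S"
  and G_meas: "(\<lambda>(u, s). G u s q) \<in> borel_measurable (restrict_space borel Q \<Otimes>\<^sub>M S)"
  and G_mean: "u \<in> Q \<Longrightarrow> integrable (\<mu> u) (\<lambda>s. G u s q)" "u \<in> Q \<Longrightarrow> (\<integral>s. G u s q \<partial>\<mu> u) = g\<^sub>o u q"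
  and G_var: "u \<in> Q \<Longrightarrow> integrable (\<mu> u) (\<lambda>s. (norm (G u s - g\<^sub>o u))\<^sup>2)"
    "u \<in> Q \<Longrightarrow> (\<integral>s. (norm (G u s - g\<^sub>o u))\<^sup>2 \<partial>\<mu> u) \<le> \<sigma>\<^sup>2"
  using stochastic by (auto simp: stochastic_oracle_def)

text \<open>\<open>g\<^sub>o\<close> inherits measurability as the mean of \<open>G\<close> under
  the kernel \<open>\<mu>\<close>.\<close>

lemma g\<^sub>o_meas: "(\<lambda>u. g\<^sub>o u q) \<in> borel_measurable (restrict_space borel Q)"
proof -
  have "(\<lambda>u. \<integral>s. G u s q \<partial>\<mu> u) \<in> borel_measurable (restrict_space borel Q)"
    by (rule integral_measurable_kernel[OF G_meas measurable_prob_algebraD[OF \<mu>_meas]])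
  then show ?thesis by (rule measurable_cong[THEN iffD1, rotated]) (simp add: space_restrict_space G_mean)
qed

lemma restrict_meas:
  "X \<in> borel_measurable N \<Longrightarrow> (\<And>\<omega>. \<omega> \<in> space N \<Longrightarrow> X \<omega> \<in> Q) \<Longrightarrow> X \<in> N \<rightarrow>\<^sub>M restrict_space borel Q"
  by (rule measurable_restrict_space2) auto

lemma \<gamma>_meas:
  assumes "x i \<in> borel_measurable (P i)"
  shows "(\<lambda>\<omega>. \<gamma> i \<omega> u) \<in> borel_measurable (P (Suc i))"
proof -
  have "x i \<in> P (Suc i) \<rightarrow>\<^sub>M restrict_space borel Q"
    by (rule restrict_meas[OF past_mono[OF _ assms]]) (auto simp: mem)
  then have "(\<lambda>\<omega>. (x i \<omega>, \<xi> i \<omega>)) \<in> P (Suc i) \<rightarrow>\<^sub>M restrict_space borel Q \<Otimes>\<^sub>M S"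
    by (intro measurable_Pair \<xi>_past) auto
  from measurable_compose[OF this G_meas] show ?thesis by (simp add: \<gamma>_def)
qed

lemma z_meas:
  assumes "\<And>i. i \<le> k \<Longrightarrow> x i \<in> borel_measurable (P i)"
  shows "z k \<in> borel_measurable (P (Suc k))"
proof (rule arg_min_measurable[OF fd h \<beta>_pos less_imp_le[OF A_pos]])
  show "(\<lambda>\<omega>. (\<Sum>i\<le>k. \<alpha> i *\<^sub>R \<gamma> i \<omega>) (u - x0)) \<in> borel_measurable (P (Suc k))" for u
  proof -
    have "(\<lambda>\<omega>. \<gamma> i \<omega> (u - x0)) \<in> borel_measurable (P (Suc k))" if "i \<le> k" for i
      by (rule past_mono[OF _ \<gamma>_meas]) (use that assms in auto)
    then show ?thesis by (auto simp: blinfun.sum_left blinfun.scaleR_left)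
  qed
  fix \<omega> assume "\<omega> \<in> space (P (Suc k))"
  then interpret r: sigm_run Q d grad_d x0 f h f\<^sub>o g\<^sub>o L \<delta> \<alpha> \<beta> B
    "\<lambda>i. \<gamma> i \<omega>" "\<lambda>i. x i \<omega>" "\<lambda>i. y i \<omega>" "\<lambda>i. z i \<omega>" "\<lambda>i. xhat i \<omega>" "\<lambda>i. w i \<omega>"
    by (intro path) simp
  show "is_arg_min (\<lambda>u. \<beta> k * d u + (\<Sum>i\<le>k. \<alpha> i *\<^sub>R \<gamma> i \<omega>) u + (\<Sum>j\<le>k. \<alpha> j) * h u) (\<lambda>u. u \<in> Q) (z k \<omega>)"
    using r.z_arg_min_\<psi>[of k] by (simp add: is_arg_min_linorder r.\<psi>_linear r.A_def)
qed

lemma y0_meas: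
  assumes "x 0 \<in> borel_measurable (P 0)"
  shows "y 0 \<in> borel_measurable (P (Suc 0))"
proof (rule arg_min_measurable[OF fd h \<beta>_pos less_imp_le[OF \<alpha>_pos]])
  show "(\<lambda>\<omega>. (\<alpha> 0 *\<^sub>R \<gamma> 0 \<omega>) (u - x0)) \<in> borel_measurable (P (Suc 0))" for u
    using \<gamma>_meas[OF assms] by (simp add: blinfun.scaleR_left)
  fix \<omega> assume "\<omega> \<in> space (P (Suc 0))"
  then interpret r: sigm_run Q d grad_d x0 f h f\<^sub>o g\<^sub>o L \<delta> \<alpha> \<beta> B
    "\<lambda>i. \<gamma> i \<omega>" "\<lambda>i. x i \<omega>" "\<lambda>i. y i \<omega>" "\<lambda>i. z i \<omega>" "\<lambda>i. xhat i \<omega>" "\<lambda>i. w i \<omega>"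
    by (intro path) simp
  show "is_arg_min (\<lambda>u. \<beta> 0 * d u + (\<alpha> 0 *\<^sub>R \<gamma> 0 \<omega>) u + \<alpha> 0 * h u) (\<lambda>u. u \<in> Q) (y 0 \<omega>)"
    using r.run_y0 by (simp add: is_arg_min_linorder blinfun.scaleR_left blinfun.diff_right algebra_simps)
qed

text \<open>Up to a constant the Bregman term is \<open>\<beta> k * d\<close> plus a linear part
  given by \<open>grad_d (z k)\<close>, so \<open>arg_min_measurable\<close> covers this subproblem
  too.\<close>

lemma xhat_meas:
  assumes "z k \<in> borel_measurable (P (Suc k))" "x (Suc k) \<in> borel_measurable (P (Suc k))"
  shows "xhat (Suc k) \<in> borel_measurable (P (Suc (Suc k)))"
proof (rule arg_min_measurable[OF fd h \<beta>_pos less_imp_le[OF \<alpha>_pos]])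
  let ?s = "\<lambda>\<omega>. \<alpha> (Suc k) *\<^sub>R \<gamma> (Suc k) \<omega> - \<beta> k *\<^sub>R grad_d (z k \<omega>)"
  show "(\<lambda>\<omega>. ?s \<omega> (u - x0)) \<in> borel_measurable (P (Suc (Suc k)))" if "u \<in> Q" for u
  proof -
    have "z k \<in> P (Suc (Suc k)) \<rightarrow>\<^sub>M restrict_space borel Q"
      by (rule restrict_meas[OF past_mono[OF _ assms(1)]]) (auto simp: mem)
    from grad_measurable[OF this that x0_mem] \<gamma>_meas[OF assms(2), of "u - x0"]
    show ?thesis by (simp add: blinfun.scaleR_left blinfun.diff_left)
  qed
  fix \<omega> assume "\<omega> \<in> space (P (Suc (Suc k)))"
  then interpret r: sigm_run Q d grad_d x0 f h f\<^sub>o g\<^sub>o L \<delta> \<alpha> \<beta> B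
    "\<lambda>i. \<gamma> i \<omega>" "\<lambda>i. x i \<omega>" "\<lambda>i. y i \<omega>" "\<lambda>i. z i \<omega>" "\<lambda>i. xhat i \<omega>" "\<lambda>i. w i \<omega>"
    by (intro path) simp
  show "is_arg_min (\<lambda>u. \<beta> k * d u + ?s \<omega> u + \<alpha> (Suc k) * h u) (\<lambda>u. u \<in> Q) (xhat (Suc k) \<omega>)"
    using r.run_xhat[of k]
    by (simp add: is_arg_min_linorder bregman_def blinfun.scaleR_left blinfun.diff_left
        blinfun.diff_right algebra_simps)
qed

text \<open>The shift in the index matters: the query point \<open>x k\<close> is known before the
  draw \<open>\<xi> k\<close>, while \<open>y k\<close> depends on it.\<close>

lemma iterates_meas: "(\<forall>i\<le>k. x i \<in> borel_measurable (P i)) \<and> y k \<in> borel_measurable (P (Suc k))"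
proof (induction k)
  case 0
  have "x 0 \<in> borel_measurable (P 0)"
    by (rule past_cong[of _ "\<lambda>_. x0"]) (simp_all add: sigm_run.run_x0[OF path])
  then show ?case using y0_meas by simp
next
  case (Suc k)
  define t where "t = \<alpha> (Suc k) / B (Suc k)"
  define \<theta> where "\<theta> = B (Suc k) / (\<Sum>j\<le>Suc k. \<alpha> j)"
  have z: "z k \<in> borel_measurable (P (Suc k))" using Suc by (intro z_meas) auto
  have x': "(\<lambda>\<omega>. t *\<^sub>R z k \<omega> + (1 - t) *\<^sub>R y k \<omega>) \<in> borel_measurable (P (Suc k))"
    using Suc by (intro borel_measurable_linear_combination[OF fd] z) auto
  have x: "x (Suc k) \<in> borel_measurable (P (Suc k))"
  proof (rule past_cong[OF _ x'])
    show "x (Suc k) \<omega> = t *\<^sub>R z k \<omega> + (1 - t) *\<^sub>R y k \<omega>" if "\<omega> \<in> space M" for \<omega>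
    using sigm_run.run_x[OF path[OF that]] sigm_run.\<tau>_def[OF path[OF that]] by (simp add: t_def)
  qed
  have y': "y k \<in> borel_measurable (P (Suc (Suc k)))" using past_mono[of "Suc k" "Suc (Suc k)"] Suc by auto
  have y'': "(\<lambda>\<omega>. \<theta> *\<^sub>R (t *\<^sub>R xhat (Suc k) \<omega> + (1 - t) *\<^sub>R y k \<omega>) + (1 - \<theta>) *\<^sub>R y k \<omega>)
      \<in> borel_measurable (P (Suc (Suc k)))"
    by (intro borel_measurable_linear_combination[OF fd] xhat_meas z x y')
  have "y (Suc k) \<in> borel_measurable (P (Suc (Suc k)))"
  proof (rule past_cong[OF _ y''])
    show "y (Suc k) \<omega> = \<theta> *\<^sub>R (t *\<^sub>R xhat (Suc k) \<omega> + (1 - t) *\<^sub>R y k \<omega>) + (1 - \<theta>) *\<^sub>R y k \<omega>"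
    if "\<omega> \<in> space M" for \<omega>
    using sigm_run.run_y'[OF path[OF that], of k] sigm_run.run_w[OF path[OF that], of k]
      sigm_run.\<tau>_def[OF path[OF that], of k] sigm_run.A_def[OF path[OF that], of "Suc k"]
    by (simp add: t_def \<theta>_def)
  qed
  then show ?case using Suc x by (auto simp: le_Suc_eq)
qed

lemma x_meas: "x i \<in> borel_measurable (P i)" and y_meas: "y i \<in> borel_measurable (P (Suc i))"
  using iterates_meas[of i] by auto

text \<open>\<open>v i\<close> has to be known before the draw \<open>\<xi> i\<close>; this is what
  gives its pairing with the noise conditional mean zero.\<close>

lemma v_meas: "v i \<in> borel_measurable (P i)"
proof -
  have "(\<lambda>\<omega>. if i = 0 then x 0 \<omega> else y (i - 1) \<omega>) \<in> borel_measurable (P i)"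
    using x_meas y_meas[of "i - 1"] by (cases i) auto
  moreover have "v i = (\<lambda>\<omega>. 1 *\<^sub>R (\<alpha> i *\<^sub>R xs + (- B i) *\<^sub>R x i \<omega>)
      + (B i - \<alpha> i) *\<^sub>R (if i = 0 then x 0 \<omega> else y (i - 1) \<omega>))"
    by (simp add: v_def fun_eq_iff algebra_simps)
  ultimately show ?thesis
    using x_meas by (simp only:) (intro borel_measurable_linear_combination[OF fd], auto)
qed

section \<open>Integrating out the draws\<close>

definition "e i \<omega> s = G (x i \<omega>) s - g\<^sub>o (x i \<omega>)"

lemma x_restrict: "x i \<in> P i \<rightarrow>\<^sub>M restrict_space borel Q"
  by (rule restrict_meas[OF x_meas]) (simp add: mem)

lemma kernel: "(\<lambda>\<omega>. \<mu> (x i \<omega>)) \<in> P i \<rightarrow>\<^sub>M prob_algebra S"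
  by (rule measurable_compose[OF x_restrict \<mu>_meas])

lemma e_meas: "(\<lambda>p. e i (fst p) (snd p) u) \<in> borel_measurable (P i \<Otimes>\<^sub>M S)"
proof -
  have 1: "(\<lambda>p. x i (fst p)) \<in> P i \<Otimes>\<^sub>M S \<rightarrow>\<^sub>M restrict_space borel Q"
    by (rule measurable_compose[OF measurable_fst x_restrict])
  then have "(\<lambda>p. (x i (fst p), snd p)) \<in> P i \<Otimes>\<^sub>M S \<rightarrow>\<^sub>M restrict_space borel Q \<Otimes>\<^sub>M S"
    by (intro measurable_Pair) auto
  from measurable_compose[OF this G_meas] measurable_compose[OF 1 g\<^sub>o_meas]
  show ?thesis by (simp add: e_def blinfun.diff_left)
qed

lemma e_norm_meas: "(\<lambda>p. (norm (e i (fst p) (snd p)))\<^sup>2) \<in> borel_measurable (P i \<Otimes>\<^sub>M S)"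
proof -
  have "(\<lambda>p. e i (fst p) (snd p)) \<in> borel_measurable (P i \<Otimes>\<^sub>M S)"
    by (rule borel_measurable_blinfun_finite_dim[OF fd e_meas])
  from borel_measurable_continuous_on[OF continuous_on_norm_id this] show ?thesis by simp
qed

text \<open>With the past frozen, \<open>T \<omega>\<close> is a constant, and only the noise has to
  be integrable, which the oracle guarantees.\<close>

lemma expectation_step:
  assumes T: "T \<in> borel_measurable (P i)" and V: "V \<in> borel_measurable (P i)" and c: "c \<ge> 0"
    and nonneg: "AE \<omega> in M. 0 \<le> T \<omega> + c * (norm (\<eta> i \<omega>))\<^sup>2 + \<eta> i \<omega> (V \<omega>)"
  shows "(\<integral>\<^sup>+\<omega>. ennreal (T \<omega> + c * (norm (\<eta> i \<omega>))\<^sup>2 + \<eta> i \<omega> (V \<omega>)) \<partial>M)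
    \<le> (\<integral>\<^sup>+\<omega>. ennreal (T \<omega> + c * \<sigma>\<^sup>2) \<partial>M)"
proof -
  define g where "g \<omega> s = T \<omega> + c * (norm (e i \<omega> s))\<^sup>2 + e i \<omega> s (V \<omega>)" for \<omega> s
  have "(\<lambda>p. e i (fst p) (snd p) (V (fst p))) \<in> borel_measurable (P i \<Otimes>\<^sub>M S)"
    by (rule borel_measurable_blinfun_apply_finite_dim[OF fd e_meas])
      (rule measurable_compose[OF measurable_fst V])
  then have g: "(\<lambda>(\<omega>, s). g \<omega> s) \<in> borel_measurable (P i \<Otimes>\<^sub>M S)"
    using e_norm_meas[of i] measurable_compose[OF measurable_fst T, of S]
    by (simp add: g_def case_prod_beta')
  \<comment> \<open>\<open>e\<close> decouples the past from the value of the draw; inserting the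
    actual draw gives back the noise.\<close>
  have \<eta>e: "e i \<omega> (\<xi> i \<omega>) = \<eta> i \<omega>" for \<omega> by (simp add: e_def \<eta>_def \<gamma>_def)
  have "AE \<omega> in M. AE s in \<mu> (x i \<omega>). 0 \<le> g \<omega> s"
    by (rule AE_fresh_draw[OF past_sub \<xi>_meas kernel draw g]) (use nonneg in \<open>simp_all add: g_def \<eta>e\<close>)
  then have inner: "AE \<omega> in M. (\<integral>\<^sup>+s. ennreal (g \<omega> s) \<partial>\<mu> (x i \<omega>)) \<le> ennreal (T \<omega> + c * \<sigma>\<^sup>2)"
  proof (rule AE_mp[OF _ AE_I2], intro impI)
    fix \<omega> assume \<omega>: "\<omega> \<in> space M" and pos: "AE s in \<mu> (x i \<omega>). 0 \<le> g \<omega> s"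
    have xQ: "x i \<omega> \<in> Q" by (rule mem[OF \<omega>])
    interpret K: prob_space "\<mu> (x i \<omega>)"
      using measurable_space[OF kernel[of i], of \<omega>] \<omega> by (simp add: space_prob_algebra)
    have int1: "integrable (\<mu> (x i \<omega>)) (\<lambda>s. T \<omega> + c * (norm (e i \<omega> s))\<^sup>2)"
      using G_var(1)[OF xQ] by (simp add: e_def)
    have int2: "integrable (\<mu> (x i \<omega>)) (\<lambda>s. e i \<omega> s (V \<omega>))"
      using G_mean(1)[OF xQ] by (simp add: e_def blinfun.diff_left)
    have mean0: "(\<integral>s. e i \<omega> s (V \<omega>) \<partial>\<mu> (x i \<omega>)) = 0"
      using G_mean[OF xQ] by (simp add: e_def blinfun.diff_left K.prob_space)
    have "(\<integral>s. g \<omega> s \<partial>\<mu> (x i \<omega>)) = T \<omega> + c * (\<integral>s. (norm (e i \<omega> s))\<^sup>2 \<partial>\<mu> (x i \<omega>))"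
      unfolding g_def using int1 int2 mean0 G_var(1)[OF xQ] by (simp add: e_def K.prob_space)
    also have "\<dots> \<le> T \<omega> + c * \<sigma>\<^sup>2"
      using G_var(2)[OF xQ] c by (auto simp: e_def intro!: mult_left_mono)
    finally have "(\<integral>s. g \<omega> s \<partial>\<mu> (x i \<omega>)) \<le> T \<omega> + c * \<sigma>\<^sup>2" .
    \<comment> \<open>The sign of \<open>g\<close> for almost every \<open>s\<close> turns the
      nonnegative integral into a signed one, in which the linear term has mean zero.\<close>
    moreover have "(\<integral>\<^sup>+s. ennreal (g \<omega> s) \<partial>\<mu> (x i \<omega>)) = ennreal (\<integral>s. g \<omega> s \<partial>\<mu> (x i \<omega>))"
      by (rule nn_integral_eq_integral[OF _ pos]) (unfold g_def, rule Bochner_Integration.integrable_add[OF int1 int2])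
    ultimately show "(\<integral>\<^sup>+s. ennreal (g \<omega> s) \<partial>\<mu> (x i \<omega>)) \<le> ennreal (T \<omega> + c * \<sigma>\<^sup>2)"
      by (simp add: ennreal_leI)
  qed
  have g': "(\<lambda>(\<omega>, s). ennreal (g \<omega> s)) \<in> borel_measurable (P i \<Otimes>\<^sub>M S)"
    using g by measurable
  have "(\<integral>\<^sup>+\<omega>. ennreal (T \<omega> + c * (norm (\<eta> i \<omega>))\<^sup>2 + \<eta> i \<omega> (V \<omega>)) \<partial>M)
      = (\<integral>\<^sup>+\<omega>. ennreal (g \<omega> (\<xi> i \<omega>)) \<partial>M)" by (simp add: g_def \<eta>e)
  also have "\<dots> = (\<integral>\<^sup>+\<omega>. (\<integral>\<^sup>+s. ennreal (g \<omega> s) \<partial>\<mu> (x i \<omega>)) \<partial>M)"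
    by (rule nn_integral_fresh_draw[OF past_sub \<xi>_meas kernel draw g'])
  also have "\<dots> \<le> (\<integral>\<^sup>+\<omega>. ennreal (T \<omega> + c * \<sigma>\<^sup>2) \<partial>M)"
    by (rule nn_integral_mono_AE[OF inner])
  finally show ?thesis .
qed

lemma \<eta>_meas: "(\<lambda>\<omega>. \<eta> i \<omega> u) \<in> borel_measurable (P (Suc i))"
proof -
  have "(\<lambda>\<omega>. g\<^sub>o (x i \<omega>) u) \<in> borel_measurable (P (Suc i))"
    by (rule past_mono[OF _ measurable_compose[OF x_restrict g\<^sub>o_meas]]) simp
  then show ?thesis using \<gamma>_meas[OF x_meas] by (simp add: \<eta>_def blinfun.diff_left)
qed

lemma \<eta>_norm_meas: "(\<lambda>\<omega>. (norm (\<eta> i \<omega>))\<^sup>2) \<in> borel_measurable (P (Suc i))"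
proof -
  have "\<eta> i \<in> borel_measurable (P (Suc i))"
    by (rule borel_measurable_blinfun_finite_dim[OF fd \<eta>_meas])
  from borel_measurable_continuous_on[OF continuous_on_norm_id this] show ?thesis by simp
qed

lemma Y_meas: "Y k \<in> borel_measurable (P (Suc k))"
proof -
  have 1: "(\<lambda>\<omega>. (norm (\<eta> i \<omega>))\<^sup>2) \<in> borel_measurable (P (Suc k))" if "i \<le> k" for i
    by (rule past_mono[OF _ \<eta>_norm_meas]) (use that in simp)
  have 2: "(\<lambda>\<omega>. \<eta> i \<omega> (v i \<omega>)) \<in> borel_measurable (P (Suc k))" if "i \<le> k" for i
    by (rule past_mono[OF _ borel_measurable_blinfun_apply_finite_dim[OF fd \<eta>_meas]])
      (use that past_mono[OF _ v_meas, of i "Suc i"] in auto)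
  show ?thesis unfolding Y_def[abs_def]
    by (intro borel_measurable_add borel_measurable_sum borel_measurable_const borel_measurable_times)
      (auto simp: 1 2)
qed

text \<open>With \<open>T = 0\<close>, \<open>V = 0\<close> and \<open>c = 1\<close> the expectation
  step bounds the mean squared noise by \<open>\<sigma>\<^sup>2\<close>, which is 0 here. Zero
  denominators are therefore harmless almost surely.\<close>

lemma \<eta>_zero: "\<beta> i = L \<Longrightarrow> AE \<omega> in M. \<eta> i \<omega> = 0"
proof -
  assume "\<beta> i = L"
  then have "\<sigma> = 0" by (rule \<beta>_eq_L)
  have "(\<integral>\<^sup>+\<omega>. ennreal (0 + 1 * (norm (\<eta> i \<omega>))\<^sup>2 + \<eta> i \<omega> 0) \<partial>M) \<le> (\<integral>\<^sup>+\<omega>. ennreal (0 + 1 * \<sigma>\<^sup>2) \<partial>M)"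
    by (rule expectation_step) (simp_all add: blinfun.zero_right)
  then have "(\<integral>\<^sup>+\<omega>. ennreal ((norm (\<eta> i \<omega>))\<^sup>2) \<partial>M) = 0"
    by (simp add: \<open>\<sigma> = 0\<close> blinfun.zero_right)
  moreover have "(\<lambda>\<omega>. ennreal ((norm (\<eta> i \<omega>))\<^sup>2)) \<in> borel_measurable M"
    using measurable_from_subalg[OF past_sub \<eta>_norm_meas[of i]] by measurable
  ultimately have "AE \<omega> in M. ennreal ((norm (\<eta> i \<omega>))\<^sup>2) = 0" by (simp add: nn_integral_0_iff_AE)
  then show ?thesis by eventually_elim (simp add: ennreal_eq_0_iff)
qed

lemma AE_bound: "AE \<omega> in M. (\<Sum>j\<le>k. \<alpha> j) * ((f (y k \<omega>) + h (y k \<omega>)) - (f xs + h xs)) \<le> Y k \<omega>"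
proof -
  have "AE \<omega> in M. \<forall>i. \<beta> i = L \<longrightarrow> \<eta> i \<omega> = 0"
    using \<eta>_zero by (auto simp: AE_all_countable)
  then show ?thesis
    by (rule AE_mp[OF _ AE_I2]) (auto intro!: path_inequality)
qed

lemma gap_nonneg: "\<omega> \<in> space M \<Longrightarrow> 0 \<le> (\<Sum>j\<le>k. \<alpha> j) * ((f (y k \<omega>) + h (y k \<omega>)) - (f xs + h xs))"
  using A_pos[of k] xs_min[OF mem(2)] by (intro mult_nonneg_nonneg) auto

lemma Y_nonneg: "AE \<omega> in M. 0 \<le> Y k \<omega>"
  using AE_bound[of k] by (rule AE_mp[OF _ AE_I2]) (use gap_nonneg[of _ k] in \<open>auto intro: order_trans\<close>)

lemma expectation_Y:
  "(\<integral>\<^sup>+\<omega>. ennreal (Y k \<omega>) \<partial>M) \<le> ennreal (\<beta> k * d xs + (\<Sum>i\<le>k. B i * \<delta> + C i * \<sigma>\<^sup>2))"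
proof (induction k)
  case 0
  have "(\<integral>\<^sup>+\<omega>. ennreal ((\<beta> 0 * d xs + B 0 * \<delta>) + C 0 * (norm (\<eta> 0 \<omega>))\<^sup>2 + \<eta> 0 \<omega> (v 0 \<omega>)) \<partial>M)
      \<le> (\<integral>\<^sup>+\<omega>. ennreal ((\<beta> 0 * d xs + B 0 * \<delta>) + C 0 * \<sigma>\<^sup>2) \<partial>M)"
    by (rule expectation_step[OF _ v_meas C_nonneg]) (use Y_nonneg[of 0] in \<open>simp_all add: Y_def add.assoc\<close>)
  then show ?case by (simp add: Y_def add.assoc emeasure_space_1)
next
  case (Suc k)
  define r where "r = (\<beta> (Suc k) - \<beta> k) * d xs + B (Suc k) * \<delta>"
  have r: "r \<ge> 0"
    using \<beta>_mono[of k] d_nonneg[OF xs_mem] B_pos[of "Suc k"] \<delta>_nonneg by (simp add: r_def)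
  have c: "C (Suc k) * \<sigma>\<^sup>2 \<ge> 0" using C_nonneg by simp
  have Y: "Y (Suc k) \<omega> = (Y k \<omega> + r) + C (Suc k) * (norm (\<eta> (Suc k) \<omega>))\<^sup>2 + \<eta> (Suc k) \<omega> (v (Suc k) \<omega>)" for \<omega>
    by (simp add: Y_def r_def algebra_simps)
  have "(\<integral>\<^sup>+\<omega>. ennreal (Y (Suc k) \<omega>) \<partial>M) \<le> (\<integral>\<^sup>+\<omega>. ennreal ((Y k \<omega> + r) + C (Suc k) * \<sigma>\<^sup>2) \<partial>M)"
    unfolding Y by (rule expectation_step[OF _ v_meas C_nonneg])
      (use Y_nonneg[of "Suc k"] Y_meas[of k] in \<open>simp_all add: Y\<close>)
  \<comment> \<open>Splitting under \<open>ennreal\<close> relies on \<open>Y k\<close> itself being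
    nonnegative almost surely, which the path bound gives at every \<open>k\<close>.\<close>
  also have "\<dots> = (\<integral>\<^sup>+\<omega>. ennreal (Y k \<omega>) + ennreal (r + C (Suc k) * \<sigma>\<^sup>2) \<partial>M)"
    by (rule nn_integral_cong_AE)
      (use Y_nonneg[of k] r c in \<open>auto simp: ennreal_plus[symmetric] add.assoc simp del: ennreal_plus\<close>)
  also have "\<dots> = (\<integral>\<^sup>+\<omega>. ennreal (Y k \<omega>) \<partial>M) + ennreal (r + C (Suc k) * \<sigma>\<^sup>2)"
    using measurable_from_subalg[OF past_sub Y_meas[of k]]
    by (subst nn_integral_add) (auto simp: emeasure_space_1)
  also have "\<dots> \<le> ennreal (\<beta> k * d xs + (\<Sum>i\<le>k. B i * \<delta> + C i * \<sigma>\<^sup>2)) + ennreal (r + C (Suc k) * \<sigma>\<^sup>2)"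
    using Suc by (intro add_right_mono)
  also have "\<dots> = ennreal (\<beta> (Suc k) * d xs + (\<Sum>i\<le>Suc k. B i * \<delta> + C i * \<sigma>\<^sup>2))"
  proof -
    have "0 \<le> \<beta> k * d xs + (\<Sum>i\<le>k. B i * \<delta> + C i * \<sigma>\<^sup>2)"
      using \<beta>_pos[of k] d_nonneg[OF xs_mem] C_nonneg B_pos \<delta>_nonneg
      by (intro add_nonneg_nonneg sum_nonneg mult_nonneg_nonneg) (auto intro: less_imp_le)
    then show ?thesis using r c
      by (subst ennreal_plus[symmetric]) (auto simp: r_def algebra_simps)
  qed
  finally show ?case .
qed

theorem expected_gap:
  "integrable M (\<lambda>\<omega>. f (y k \<omega>) + h (y k \<omega>))"
  "(\<Sum>j\<le>k. \<alpha> j) * ((\<integral>\<omega>. f (y k \<omega>) + h (y k \<omega>) \<partial>M) - (f xs + h xs))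
    \<le> \<beta> k * d xs + (\<Sum>i\<le>k. B i * \<delta> + B i * \<sigma>\<^sup>2 / (2 * (\<beta> i - L)))"
proof -
  let ?A = "\<Sum>j\<le>k. \<alpha> j"
  let ?b = "\<beta> k * d xs + (\<Sum>i\<le>k. B i * \<delta> + C i * \<sigma>\<^sup>2)"
  define D where "D \<omega> = ?A * ((f (y k \<omega>) + h (y k \<omega>)) - (f xs + h xs))" for \<omega>
  have b: "0 \<le> ?b"
    using \<beta>_pos[of k] d_nonneg[OF xs_mem] C_nonneg B_pos \<delta>_nonneg
    by (intro add_nonneg_nonneg sum_nonneg mult_nonneg_nonneg) (auto intro: less_imp_le)
  have D: "D \<in> borel_measurable M" unfolding D_def using obj_meas[of k] by measurable
  have D0: "AE \<omega> in M. 0 \<le> D \<omega>" using gap_nonneg by (auto simp: D_def)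
  have "(\<integral>\<^sup>+\<omega>. ennreal (D \<omega>) \<partial>M) \<le> (\<integral>\<^sup>+\<omega>. ennreal (Y k \<omega>) \<partial>M)"
    by (rule nn_integral_mono_AE) (use AE_bound[of k] in \<open>auto simp: D_def ennreal_leI\<close>)
  also have "\<dots> \<le> ennreal ?b" by (rule expectation_Y)
  finally have le: "(\<integral>\<^sup>+\<omega>. ennreal (D \<omega>) \<partial>M) \<le> ennreal ?b" .
  have int: "integrable M D"
    by (rule integrableI_nonneg[OF D D0]) (rule le_less_trans[OF le], simp)
  have eq: "f (y k \<omega>) + h (y k \<omega>) = D \<omega> / ?A + (f xs + h xs)" for \<omega>
    using A_pos[of k] by (simp add: D_def)
  show *: "integrable M (\<lambda>\<omega>. f (y k \<omega>) + h (y k \<omega>))"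
    unfolding eq using int by simp
  have "ennreal (\<integral>\<omega>. D \<omega> \<partial>M) \<le> ennreal ?b"
    using le nn_integral_eq_integral[OF int D0] by simp
  then have "(\<integral>\<omega>. D \<omega> \<partial>M) \<le> ?b" using b by (simp add: ennreal_le_iff)
  moreover have "(\<integral>\<omega>. D \<omega> \<partial>M) = ?A * ((\<integral>\<omega>. f (y k \<omega>) + h (y k \<omega>) \<partial>M) - (f xs + h xs))"
    unfolding D_def using * by (simp add: prob_space)
  ultimately show "?A * ((\<integral>\<omega>. f (y k \<omega>) + h (y k \<omega>) \<partial>M) - (f xs + h xs))
    \<le> \<beta> k * d xs + (\<Sum>i\<le>k. B i * \<delta> + B i * \<sigma>\<^sup>2 / (2 * (\<beta> i - L)))"
    by (simp add: C_def)
qed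

end

section \<open>The step sizes\<close>

lemma powr_diff_mvt:
  fixes u v q :: real
  assumes "0 < u" "u < v"
  obtains c where "u < c" "c < v" "v powr q - u powr q = (v - u) * (q * c powr (q - 1))"
proof -
  have "\<exists>c. u < c \<and> c < v \<and> v powr q - u powr q = (v - u) * (q * c powr (q - 1))"
    using assms by (intro MVT2) (auto intro!: has_real_derivative_powr)
  then show ?thesis using that by blast
qed

text \<open>Consecutive values of \<open>(k + p) / p\<close> differ by \<open>1 / p\<close>, which
  cancels the factor \<open>p\<close> from differentiating the power; at \<open>k = 0\<close> both
  sides are 1.\<close>

lemma sum_powr_ge:
  assumes "p \<ge> 1"
  shows "((real k + p) / p) powr p \<le> (\<Sum>i\<le>k. ((real i + p) / p) powr (p - 1))"
proof (induction k)
  case 0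
  then show ?case using assms by simp
next
  case (Suc k)
  define u v where "u = (real k + p) / p" and "v = (real (Suc k) + p) / p"
  have uv: "0 < u" "u < v" "v - u = 1 / p"
    using assms by (auto simp: u_def v_def divide_strict_right_mono simp flip: diff_divide_distrib)
  then obtain c where c: "u < c" "c < v" "v powr p - u powr p = (v - u) * (p * c powr (p - 1))"
    using powr_diff_mvt by blast
  have "v powr p - u powr p = c powr (p - 1)" using c(3) uv(3) assms by simp
  also have "\<dots> \<le> v powr (p - 1)" using c uv assms by (intro powr_mono2) auto
  finally show ?case using Suc unfolding u_def v_def by simp
qed

text \<open>Comparison with an integral, whose integrand increases or decreases according to whether
  \<open>q \<ge> 1\<close>. Both cases occur, since \<open>p - 1/2\<close> will take the place of
  \<open>q\<close>. The base \<open>k + p + 2\<close> is the last right endpoint in the increasing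
  case.\<close>

lemma sum_powr_le:
  fixes p q :: real
  assumes "p > 0" "q > 0"
  shows "(\<Sum>i\<le>k. (real i + p + 1) powr (q - 1)) \<le> (real k + p + 2) powr q / q"
proof (cases "q \<ge> 1")
  case True
  have "(\<Sum>i\<le>k. q * (real i + p + 1) powr (q - 1)) \<le> (real k + p + 2) powr q"
  proof (induction k)
    case 0
    obtain c where c: "p + 1 < c" "c < p + 2"
      "(p + 2) powr q - (p + 1) powr q = (p + 2 - (p + 1)) * (q * c powr (q - 1))"
      using powr_diff_mvt[of "p + 1" "p + 2" q] assms by auto
    have "(p + 1) powr (q - 1) \<le> c powr (q - 1)"
      using True assms c by (intro powr_mono2) auto
    then have "q * (p + 1) powr (q - 1) \<le> q * c powr (q - 1)" using assms by simp
    then have "q * (p + 1) powr (q - 1) \<le> (p + 2) powr q - (p + 1) powr q" using c(3) by simp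
    then have "q * (p + 1) powr (q - 1) \<le> (p + 2) powr q"
      using powr_ge_zero[of "p + 1" q] by linarith
    then show ?case by simp
  next
    case (Suc k)
    define t where "t = real k + p + 2"
    obtain c where c: "t < c" "c < t + 1"
      "(t + 1) powr q - t powr q = ((t + 1) - t) * (q * c powr (q - 1))"
      using powr_diff_mvt[of t "t + 1" q] assms by (auto simp: t_def)
    have "t powr (q - 1) \<le> c powr (q - 1)"
      using True assms c by (intro powr_mono2) (auto simp: t_def)
    then have "q * t powr (q - 1) \<le> q * c powr (q - 1)" using assms by simp
    then have "q * t powr (q - 1) \<le> (t + 1) powr q - t powr q" using c(3) by simp
    moreover have "real (Suc k) + p + 1 = t" "real (Suc k) + p + 2 = t + 1" by (auto simp: t_def)
    moreover have "(\<Sum>i\<le>k. q * (real i + p + 1) powr (q - 1)) \<le> t powr q"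
      using Suc by (simp add: t_def)
    ultimately show ?case by (simp only: sum.atMost_Suc)
  qed
  then show ?thesis using assms by (simp add: sum_distrib_left[symmetric] pos_le_divide_eq mult.commute)
next
  case False
  have step: "q * (t + 1) powr (q - 1) \<le> (t + 1) powr q - t powr q" if t: "t > 0" for t
  proof -
    obtain c where c: "t < c" "c < t + 1"
      "(t + 1) powr q - t powr q = ((t + 1) - t) * (q * c powr (q - 1))"
      using powr_diff_mvt[of t "t + 1" q] t by auto
    have "(t + 1) powr (q - 1) \<le> c powr (q - 1)"
      using False c t by (intro powr_mono2') auto
    then show ?thesis using c(3) assms by simp
  qed
  have "(\<Sum>i\<le>k. q * (real i + p + 1) powr (q - 1)) \<le> (real k + p + 1) powr q"
  proof (induction k)
    case 0
    have "q * (p + 1) powr (q - 1) \<le> (p + 1) powr q"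
      using step[OF assms(1)] powr_ge_zero[of p q] by linarith
    then show ?case by simp
  next
    case (Suc k)
    have "real k + p + 2 = (real k + p + 1) + 1" by simp
    then show ?case using Suc step[of "real k + p + 1"] assms by (simp add: add_ac)
  qed
  also have "\<dots> \<le> (real k + p + 2) powr q" using assms by (intro powr_mono2) auto
  finally show ?thesis using assms by (simp add: sum_distrib_left[symmetric] pos_le_divide_eq mult.commute)
qed

locale sigm_parameters =
  fixes p L \<sigma> R a b :: real and \<alpha> \<beta> B :: "nat \<Rightarrow> real"
  assumes p: "1 \<le> p" "p \<le> 2" and L: "L > 0" and \<sigma>: "\<sigma> \<ge> 0" and R: "R > 0"
    and a: "a = 2 powr ((2 * p - 1) / 2)"
    and b: "b = 2 powr ((5 - 2 * p) / 4) * p powr ((1 - 2 * p) / 2)"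
    and \<alpha>: "\<And>i. \<alpha> i = 1 / a * ((real i + p) / p) powr (p - 1)"
    and \<beta>: "\<And>i. \<beta> i = L + b * \<sigma> / R * (real i + p + 1) powr ((2 * p - 1) / 2)"
    and B: "\<And>i. B i = a * (\<alpha> i)\<^sup>2"
begin

definition "s i = (real i + p) / p"
definition "q = (2 * p - 1) / 2"

lemma a_ge: "a \<ge> 1" unfolding a using p by (intro ge_one_powr_ge_zero) auto
lemma b_pos: "b > 0" unfolding b using p by simp
lemma s_ge: "s i \<ge> 1" using p by (simp add: s_def)
lemma s_mono: "i \<le> k \<Longrightarrow> s i \<le> s k" using p by (simp add: s_def divide_right_mono)
lemma q_pos: "q > 0" using p by (simp add: q_def)
lemma \<alpha>_eq: "\<alpha> i = s i powr (p - 1) / a" by (simp add: \<alpha> s_def)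
lemma s_powr_ge: "s i powr (p - 1) \<ge> 1" using s_ge p by (intro ge_one_powr_ge_zero) auto
lemma \<alpha>_pos: "\<alpha> i > 0" using a_ge s_ge[of i] by (simp add: \<alpha>_eq)
lemma B_eq: "B i = s i powr (p - 1) * \<alpha> i"
  using a_ge by (simp add: B \<alpha>_eq power2_eq_square)
lemma s_0: "s 0 = 1" using p by (simp add: s_def)

lemma \<alpha>_0: "\<alpha> 0 \<le> 1" using a_ge by (simp add: \<alpha>_eq s_0)
lemma B_0: "B 0 = \<alpha> 0" by (simp add: B_eq s_0)

lemma \<alpha>_le_B: "\<alpha> i \<le> B i"
  using mult_right_mono[OF s_powr_ge[of i] less_imp_le[OF \<alpha>_pos[of i]]] by (simp add: B_eq)

lemma A_ge: "s k powr p / a \<le> (\<Sum>i\<le>k. \<alpha> i)"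
proof -
  have "(\<Sum>i\<le>k. \<alpha> i) = (\<Sum>i\<le>k. s i powr (p - 1)) / a"
    by (simp add: \<alpha>_eq sum_divide_distrib)
  then show ?thesis
    using sum_powr_ge[OF p(1), of k] a_ge by (simp add: s_def divide_right_mono)
qed

text \<open>\<open>B i\<close> carries the exponent \<open>2 * p - 2\<close>, which is at most
  \<open>p\<close> exactly when \<open>p \<le> 2\<close>; the base \<open>s i\<close> is at least
  1.\<close>

lemma B_le_A: "B i \<le> (\<Sum>j\<le>i. \<alpha> j)"
proof -
  have "B i = s i powr (p - 1 + (p - 1)) / a" unfolding B_eq \<alpha>_eq powr_add by simp
  also have "\<dots> \<le> s i powr p / a"
    using a_ge s_ge[of i] p by (intro divide_right_mono powr_mono) auto
  finally show ?thesis using A_ge[of i] by simp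
qed

lemma \<beta>_eq: "\<beta> i = L + b * \<sigma> / R * (real i + p + 1) powr q" by (simp add: \<beta> q_def)

lemma noise_nonneg: "b * \<sigma> / R \<ge> 0" using b_pos \<sigma> R by simp

lemma \<beta>_ge: "L \<le> \<beta> i"
  unfolding \<beta>_eq using mult_nonneg_nonneg[OF noise_nonneg powr_ge_zero] by simp

lemma \<beta>_mono: "\<beta> i \<le> \<beta> (Suc i)"
  unfolding \<beta>_eq using noise_nonneg p q_pos
  by (intro add_left_mono mult_left_mono powr_mono2) auto

text \<open>The base of the power at most doubles in one step, and \<open>2 powr q\<close> is
  \<open>a\<close>. This is the source of \<open>a\<close>.\<close>

lemma \<beta>_Suc_le: "\<beta> (Suc i) \<le> a * \<beta> i"
proof -
  have "(real (Suc i) + p + 1) powr q \<le> (2 * (real i + p + 1)) powr q"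
    using p q_pos by (intro powr_mono2) auto
  also have "\<dots> = a * (real i + p + 1) powr q" 
    using powr_mult[of 2 "real i + p + 1" q] p by (simp only: a q_def)
  finally have "b * \<sigma> / R * (real (Suc i) + p + 1) powr q \<le> b * \<sigma> / R * (a * (real i + p + 1) powr q)"
    using noise_nonneg by (intro mult_left_mono)
  moreover have "L \<le> a * L" using a_ge L by simp
  ultimately show ?thesis unfolding \<beta>_eq by (simp add: distrib_left mult_ac)
qed

lemma step_cond: "(\<alpha> (Suc i))\<^sup>2 * \<beta> (Suc i) \<le> B (Suc i) * \<beta> i"
  using mult_left_mono[OF \<beta>_Suc_le, of "(\<alpha> (Suc i))\<^sup>2" i] by (simp add: B mult_ac)

lemma \<beta>_eq_L: "\<beta> i = L \<Longrightarrow> \<sigma> = 0"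
  using b_pos R p by (auto simp: \<beta>_eq)

text \<open>The ratio of \<open>B i\<close> to \<open>\<alpha> i\<close> is
  \<open>s i powr (p - 1)\<close>, nondecreasing in \<open>i\<close>, so its last value factors out
  and becomes the multiplier of \<open>\<delta>\<close>.\<close>

lemma sum_B_le: "(\<Sum>i\<le>k. B i) \<le> s k powr (p - 1) * (\<Sum>i\<le>k. \<alpha> i)"
  unfolding sum_distrib_left
proof (rule sum_mono)
  fix i assume "i \<in> {..k}"
  then have "s i powr (p - 1) \<le> s k powr (p - 1)"
    using p s_mono[of i k] s_ge[of i] by (intro powr_mono2) auto
  then show "B i \<le> s k powr (p - 1) * \<alpha> i"
    unfolding B_eq using \<alpha>_pos[of i] by (intro mult_right_mono) auto
qed

text \<open>The powers combine to \<open>2 * p - 2 - q = q - 1\<close>, because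
  \<open>2 * q = 2 * p - 1\<close>. Summed noise therefore grows with exponent \<open>q\<close>,
  like the noise part of \<open>\<beta>\<close>.\<close>

lemma noise_term_le:
  "B i * \<sigma>\<^sup>2 / (2 * (\<beta> i - L)) \<le> \<sigma> * R * p powr (2 - 2 * p) / (2 * a * b) * (real i + p + 1) powr (q - 1)"
proof (cases "\<sigma> = 0")
  case False
  define t where "t = real i + p + 1"
  have t: "t > 0" using p by (simp add: t_def)
  have "s i powr (2 * p - 2) = (real i + p) powr (2 * p - 2) * p powr (2 - 2 * p)"
    using p by (simp add: s_def powr_divide powr_minus_divide[symmetric])
      (simp add: divide_inverse powr_minus[symmetric])
  also have "\<dots> \<le> t powr (2 * p - 2) * p powr (2 - 2 * p)"
    using p by (intro mult_right_mono powr_mono2) (auto simp: t_def)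
  finally have s: "s i powr (2 * p - 2) \<le> t powr (2 * p - 2) * p powr (2 - 2 * p)" .
  have "B i = s i powr (p - 1 + (p - 1)) / a" unfolding B_eq \<alpha>_eq powr_add by simp
  then have B: "B i = s i powr (2 * p - 2) / a" by (simp add: algebra_simps)
  have \<beta>L: "\<beta> i - L = b * \<sigma> / R * t powr q" by (simp add: \<beta>_eq t_def)
  have "B i * \<sigma>\<^sup>2 / (2 * (\<beta> i - L)) = \<sigma> * R / (2 * a * b) * (s i powr (2 * p - 2) / t powr q)"
    unfolding B \<beta>L using False R by (simp add: field_simps power2_eq_square)
  also have "\<dots> \<le> \<sigma> * R / (2 * a * b) * (t powr (2 * p - 2) * p powr (2 - 2 * p) / t powr q)"
    using s \<sigma> R a_ge b_pos by (intro mult_left_mono divide_right_mono) auto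
  also have "t powr (2 * p - 2) * p powr (2 - 2 * p) / t powr q = p powr (2 - 2 * p) * t powr (q - 1)"
  proof -
    have "t powr (2 * p - 2) / t powr q = t powr (q - 1)"
      by (simp add: powr_diff[symmetric] q_def field_simps)
    then show ?thesis by (simp add: mult.commute times_divide_eq_right[symmetric] del: times_divide_eq_right)
  qed
  finally show ?thesis by (simp add: t_def mult_ac)
qed simp

text \<open>\<open>b\<close> makes \<open>a * b * p powr p\<close> equal to the right-hand side
  \<open>c\<close>, so the prox term contributes \<open>c / 2\<close>. The noise contributes
  \<open>c * p / (8 * q)\<close>, which is at most \<open>c / 2\<close>.\<close>

lemma constant_bound:
  "a * p powr p * (b / 2 + p powr (2 - 2 * p) / (2 * a * b * q)) \<le> 2 powr ((3 + 2 * p) / 4) * sqrt p"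
proof -
  define c where "c = 2 powr ((3 + 2 * p) / 4) * sqrt p"
  have c: "c > 0" using p by (simp add: c_def)
  have sq: "sqrt p = p powr (1/2)" using p by (simp add: powr_half_sqrt)
  have "a * b * p powr p = 2 powr (((2 * p - 1) / 2) + ((5 - 2 * p) / 4)) * p powr (((1 - 2 * p) / 2) + p)"
    unfolding a b powr_add by (simp add: mult_ac)
  also have "((2 * p - 1) / 2) + ((5 - 2 * p) / 4) = (3 + 2 * p) / 4" by (simp add: field_simps)
  also have "((1 - 2 * p) / 2) + p = 1 / 2" by (simp add: field_simps)
  finally have 1: "a * b * p powr p = c" by (simp add: c_def sq)
  have 2: "p powr p * p powr (2 - 2 * p) = p * c * b / 4"
  proof -
    have "c * b = 2 powr ((3 + 2 * p) / 4 + (5 - 2 * p) / 4) * p powr (1 / 2 + (1 - 2 * p) / 2)"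
      unfolding b c_def sq powr_add by (simp add: mult_ac)
    also have "(3 + 2 * p) / 4 + (5 - 2 * p) / 4 = 2" by (simp add: field_simps)
    also have "1 / 2 + (1 - 2 * p) / 2 = 1 - p" by (simp add: field_simps)
    finally have cb: "c * b = 4 * p powr (1 - p)" by simp
    have "p powr p * p powr (2 - 2 * p) = p powr (1 + (1 - p))"
      by (simp add: powr_add[symmetric])
    also have "\<dots> = p * p powr (1 - p)" using p by (simp only: powr_add) simp
    finally show ?thesis using cb by simp
  qed
  have "a * p powr p * (b / 2 + p powr (2 - 2 * p) / (2 * a * b * q))
      = a * b * p powr p / 2 + p powr p * p powr (2 - 2 * p) / (2 * b * q)"
    using a_ge b_pos q_pos by (simp add: field_simps)
  also have "\<dots> = c / 2 + p * c * b / 4 / (2 * b * q)" unfolding 1 2 ..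
  also have "\<dots> = c / 2 + c * (p / (8 * q))" using b_pos q_pos by (simp add: field_simps)
  also have "\<dots> \<le> c / 2 + c * (1 / 2)"
    using c p q_pos by (intro add_left_mono mult_left_mono) (auto simp: q_def divide_le_eq)
  finally show ?thesis by (simp add: c_def[symmetric])
qed

theorem rate:
  fixes D \<delta> :: real
  assumes D: "0 \<le> D" "2 * D \<le> R\<^sup>2" and \<delta>: "\<delta> \<ge> 0"
    and gap: "(\<Sum>j\<le>k. \<alpha> j) * g \<le> \<beta> k * D + (\<Sum>i\<le>k. B i * \<delta> + B i * \<sigma>\<^sup>2 / (2 * (\<beta> i - L)))"
  shows "g \<le> L * R\<^sup>2 * p powr p * 2 powr ((2 * p - 3) / 2) / (real k + p) powr p
           + \<sigma> * R * 2 powr ((3 + 2 * p) / 4) * sqrt p * (real k + p + 2) powr (p - 1 / 2)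
               / (real k + p) powr p
           + 2 powr (2 * p - 1) * (((real k + p) / p) powr (p - 1) + 1) * \<delta>"
proof -
  define A where "A = (\<Sum>j\<le>k. \<alpha> j)"
  define W where "W = p powr p * a / (real k + p) powr p"
  have "s k powr p / a > 0" using s_ge[of k] a_ge by simp
  then have A: "A > 0" using A_ge[of k] unfolding A_def by linarith
  have W0: "W \<ge> 0" using a_ge by (simp add: W_def)
  have "s k powr p / a = 1 / W" using p a_ge by (simp add: W_def s_def powr_divide)
  then have "1 / W \<le> A" "1 / W > 0" using A_ge[of k] \<open>s k powr p / a > 0\<close> by (auto simp: A_def)
  then have AW: "1 / A \<le> W" using A by (simp add: field_simps)
  \<comment> \<open>The base from the noise sum also replaces the smaller one in
    \<open>\<beta> k\<close>, so both terms share the factor \<open>t\<close>.\<close>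
  define t where "t = (real k + p + 2) powr q"
  have "(real k + p + 1) powr q \<le> t" unfolding t_def using p q_pos by (intro powr_mono2) auto
  then have "\<beta> k \<le> L + b * \<sigma> / R * t"
    unfolding \<beta>_eq using noise_nonneg by (intro add_left_mono mult_left_mono)
  moreover have "L + b * \<sigma> / R * t \<ge> 0"
    using noise_nonneg L by (intro add_nonneg_nonneg mult_nonneg_nonneg) (auto simp: t_def)
  ultimately have "\<beta> k * D \<le> (L + b * \<sigma> / R * t) * (R\<^sup>2 / 2)"
    using D by (intro mult_mono) auto
  also have "\<dots> = L * R\<^sup>2 / 2 + \<sigma> * R * t * (b / 2)"
    using R by (simp add: field_simps power2_eq_square)
  finally have 1: "\<beta> k * D \<le> L * R\<^sup>2 / 2 + \<sigma> * R * t * (b / 2)" .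
  have "(\<Sum>i\<le>k. B i * \<sigma>\<^sup>2 / (2 * (\<beta> i - L)))
      \<le> \<sigma> * R * p powr (2 - 2 * p) / (2 * a * b) * (\<Sum>i\<le>k. (real i + p + 1) powr (q - 1))"
    unfolding sum_distrib_left by (rule sum_mono) (rule noise_term_le)
  also have "\<dots> \<le> \<sigma> * R * p powr (2 - 2 * p) / (2 * a * b) * (t / q)"
    unfolding t_def using sum_powr_le[of p q k] p q_pos \<sigma> R a_ge b_pos by (intro mult_left_mono) auto
  also have "\<dots> = \<sigma> * R * t * (p powr (2 - 2 * p) / (2 * a * b * q))" by (simp add: field_simps)
  finally have 2: "(\<Sum>i\<le>k. B i * \<sigma>\<^sup>2 / (2 * (\<beta> i - L)))
      \<le> \<sigma> * R * t * (p powr (2 - 2 * p) / (2 * a * b * q))" .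
  have 3: "(\<Sum>i\<le>k. B i * \<delta>) \<le> s k powr (p - 1) * A * \<delta>"
    unfolding sum_distrib_right[symmetric] A_def using sum_B_le \<delta> by (intro mult_right_mono)
  define N where "N = L * R\<^sup>2 / 2 + \<sigma> * R * t * (b / 2 + p powr (2 - 2 * p) / (2 * a * b * q))"
  have N0: "N \<ge> 0" unfolding N_def
    using L \<sigma> R b_pos a_ge q_pos
    by (intro add_nonneg_nonneg mult_nonneg_nonneg divide_nonneg_nonneg) (auto simp: t_def)
  have "A * g \<le> N + s k powr (p - 1) * A * \<delta>"
    using gap 1 2 3 by (simp add: A_def N_def sum.distrib distrib_left)
  then have "g \<le> (N + s k powr (p - 1) * A * \<delta>) / A" using A by (simp add: pos_le_divide_eq mult.commute)
  also have "\<dots> = N * (1 / A) + s k powr (p - 1) * \<delta>" using A by (simp add: field_simps)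
  also have "\<dots> \<le> N * W + s k powr (p - 1) * \<delta>"
    using AW N0 by (intro add_right_mono mult_left_mono)
  also have "N * W \<le> L * R\<^sup>2 * p powr p * 2 powr ((2 * p - 3) / 2) / (real k + p) powr p
      + \<sigma> * R * 2 powr ((3 + 2 * p) / 4) * sqrt p * (real k + p + 2) powr (p - 1 / 2)
          / (real k + p) powr p"
  proof -
    have "(2 * p - 1) / 2 = (2 * p - 3) / 2 + 1" by (simp add: field_simps)
    then have a2: "a = 2 powr ((2 * p - 3) / 2) * 2" unfolding a by (simp only: powr_add) simp
    have qp: "q = p - 1 / 2" by (simp add: q_def field_simps)
    let ?c = "b / 2 + p powr (2 - 2 * p) / (2 * a * b * q)"
    have "N * W = L * R\<^sup>2 / 2 * (p powr p * a) / (real k + p) powr p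
        + \<sigma> * R * t * (a * p powr p * ?c) / (real k + p) powr p"
      by (simp only: N_def W_def distrib_right) (simp add: mult_ac)
    also have "\<sigma> * R * t * (a * p powr p * ?c) / (real k + p) powr p
        \<le> \<sigma> * R * t * (2 powr ((3 + 2 * p) / 4) * sqrt p) / (real k + p) powr p"
      using \<sigma> R by (intro divide_right_mono mult_left_mono constant_bound) (auto simp: t_def)
    also have "\<dots> = \<sigma> * R * 2 powr ((3 + 2 * p) / 4) * sqrt p * (real k + p + 2) powr (p - 1 / 2)
          / (real k + p) powr p"
      by (simp add: t_def qp mult_ac)
    also have "L * R\<^sup>2 / 2 * (p powr p * a) / (real k + p) powr p
        = L * R\<^sup>2 * p powr p * 2 powr ((2 * p - 3) / 2) / (real k + p) powr p"
      unfolding a2 by simp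
    finally show ?thesis by simp
  qed
  also have "s k powr (p - 1) * \<delta> \<le> 2 powr (2 * p - 1) * (((real k + p) / p) powr (p - 1) + 1) * \<delta>"
  proof (rule mult_right_mono[OF _ \<delta>])
    have "1 * s k powr (p - 1) \<le> 2 powr (2 * p - 1) * (s k powr (p - 1) + 1)"
      using p by (intro mult_mono) (auto intro!: ge_one_powr_ge_zero)
    then show "s k powr (p - 1) \<le> 2 powr (2 * p - 1) * (((real k + p) / p) powr (p - 1) + 1)"
      by (simp add: s_def)
  qed
  finally show ?thesis by simp
qed

end

section \<open>Absolute constants and the asymptotic form\<close>

lemma simplified_rate:
  fixes p L \<sigma> \<delta> R :: real and k :: nat
  assumes p: "1 \<le> p" "p \<le> 2" and k: "k \<ge> 1" and nn: "L \<ge> 0" "\<sigma> \<ge> 0" "R \<ge> 0" "\<delta> \<ge> 0"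
  shows "L * R\<^sup>2 * p powr p * 2 powr ((2 * p - 3) / 2) / (real k + p) powr p
         + \<sigma> * R * 2 powr ((3 + 2 * p) / 4) * sqrt p * (real k + p + 2) powr (p - 1 / 2)
             / (real k + p) powr p
         + 2 powr (2 * p - 1) * (((real k + p) / p) powr (p - 1) + 1) * \<delta>
         \<le> (4 * sqrt 2) * L * R\<^sup>2 / real k powr p + (16 * sqrt 2) * \<sigma> * R / sqrt (real k)
           + 48 * real k powr (p - 1) * \<delta>"
proof (intro add_mono)
  have k': "real k \<ge> 1" using k by simp
  have s2: "sqrt 2 = 2 powr (1/2)" by (simp add: powr_half_sqrt)
  \<comment> \<open>The two factors are largest at \<open>p = 2\<close>, with values 4 and
    \<open>sqrt 2\<close>; hence \<open>4 * sqrt 2\<close>.\<close>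
  have "p powr p \<le> 2 powr 2"
    using p by (intro order_trans[OF powr_mono2 powr_mono]) auto
  moreover have "2 powr ((2 * p - 3) / 2) \<le> (2::real) powr (1/2)" using p by (intro powr_mono) auto
  ultimately have "p powr p * 2 powr ((2 * p - 3) / 2) \<le> 4 * sqrt 2"
    unfolding s2 by (intro mult_mono) auto
  then have "L * R\<^sup>2 * (p powr p * 2 powr ((2 * p - 3) / 2)) \<le> L * R\<^sup>2 * (4 * sqrt 2)"
    using nn by (intro mult_left_mono) auto
  moreover have "real k powr p \<le> (real k + p) powr p" using p k' by (intro powr_mono2) auto
  ultimately show "L * R\<^sup>2 * p powr p * 2 powr ((2 * p - 3) / 2) / (real k + p) powr p
      \<le> (4 * sqrt 2) * L * R\<^sup>2 / real k powr p"
    using nn k' by (intro frac_le) (auto simp: mult_ac)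
  define t where "t = real k + p"
  have t: "t \<ge> 1" "t \<ge> real k" "real k + p + 2 \<le> 2 * t" using p k' by (auto simp: t_def)
  have "(real k + p + 2) powr (p - 1/2) \<le> (2 * t) powr (p - 1/2)"
    using t p by (intro powr_mono2) auto
  also have "\<dots> = 2 powr (p - 1/2) * (t powr p / t powr (1/2))"
    using t by (simp add: powr_mult powr_diff)
  finally have "(real k + p + 2) powr (p - 1/2) / t powr p \<le> 2 powr (p - 1/2) / t powr (1/2)"
    using t by (simp add: divide_le_eq)
  also have "\<dots> \<le> 2 powr (3/2) / sqrt (real k)"
    using t p k' unfolding powr_half_sqrt[symmetric, OF order_trans[OF zero_le_one k']]
    by (intro frac_le powr_mono powr_mono2) auto
  finally have 1: "(real k + p + 2) powr (p - 1/2) / t powr p \<le> 2 powr (3/2) / sqrt (real k)" .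
  \<comment> \<open>Together with \<open>sqrt p \<le> sqrt 2\<close> and
    \<open>2 powr (3/2) \<le> 4\<close> this gives \<open>16 * sqrt 2\<close>.\<close>
  have "2 powr ((3 + 2 * p) / 4) \<le> (2::real) powr 2" using p by (intro powr_mono) auto
  moreover have "sqrt p \<le> sqrt 2" using p by simp
  ultimately have "2 powr ((3 + 2 * p) / 4) * sqrt p * ((real k + p + 2) powr (p - 1/2) / t powr p)
      \<le> 2 powr 2 * sqrt 2 * (2 powr (3/2) / sqrt (real k))"
    using 1 p by (intro mult_mono) auto
  also have "\<dots> \<le> 16 * sqrt 2 / sqrt (real k)"
  proof -
    have "(2::real) powr (3/2) \<le> 2 powr 2" by (intro powr_mono) auto
    then show ?thesis using k' by (simp add: field_simps)
  qed
  finally have "\<sigma> * R * (2 powr ((3 + 2 * p) / 4) * sqrt p * ((real k + p + 2) powr (p - 1/2) / t powr p))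
      \<le> \<sigma> * R * (16 * sqrt 2 / sqrt (real k))"
    using nn by (intro mult_left_mono) auto
  then show "\<sigma> * R * 2 powr ((3 + 2 * p) / 4) * sqrt p * (real k + p + 2) powr (p - 1 / 2) / (real k + p) powr p
      \<le> (16 * sqrt 2) * \<sigma> * R / sqrt (real k)"
    by (simp add: t_def mult_ac)
  \<comment> \<open>These give \<open>(k + p) / p \<le> 2 * k\<close>; the resulting factor is 8 * 3
    = 24, within 48.\<close>
  have "real k * 1 \<le> real k * p" "1 * p \<le> real k * p"
    using p k' by (auto intro!: mult_left_mono mult_right_mono)
  then have "real k + p \<le> 2 * (real k * p)" by linarith
  then have "(real k + p) / p \<le> 2 * real k" using p by (simp add: divide_le_eq mult.assoc)
  then have "((real k + p) / p) powr (p - 1) \<le> (2 * real k) powr (p - 1)"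
    using p by (intro powr_mono2) auto
  also have "\<dots> = 2 powr (p - 1) * real k powr (p - 1)" by (simp add: powr_mult)
  also have "\<dots> \<le> 2 powr 1 * real k powr (p - 1)" using p by (intro mult_right_mono powr_mono) auto
  finally have "((real k + p) / p) powr (p - 1) \<le> 2 * real k powr (p - 1)" by simp
  moreover have "1 \<le> real k powr (p - 1)" using k' p by (intro ge_one_powr_ge_zero) auto
  ultimately have "((real k + p) / p) powr (p - 1) + 1 \<le> 3 * real k powr (p - 1)" by simp
  moreover have "2 powr (2 * p - 1) \<le> (2::real) powr 3" using p by (intro powr_mono) auto
  ultimately have "2 powr (2 * p - 1) * (((real k + p) / p) powr (p - 1) + 1) \<le> 2 powr 3 * (3 * real k powr (p - 1))"
    by (intro mult_mono) auto
  also have "\<dots> \<le> 48 * real k powr (p - 1)" by simp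
  finally show "2 powr (2 * p - 1) * (((real k + p) / p) powr (p - 1) + 1) * \<delta> \<le> 48 * real k powr (p - 1) * \<delta>"
    using nn by (intro mult_right_mono)
qed

text \<open>For a principal filter "eventually" means everywhere on the set, so the comparison
  constants 1 and 48 are uniform in \<open>k\<close> and in all parameters.\<close>

lemma bigtheta_rate:
  "(\<lambda>(k, p, L, \<sigma>, \<delta>, R).
        (4 * sqrt 2) * L * R\<^sup>2 / real k powr p + (16 * sqrt 2) * \<sigma> * R / sqrt (real k)
          + 48 * real k powr (p - 1) * \<delta>)
       \<in> \<Theta>[principal {(k::nat, p, L, \<sigma>, \<delta>, R).
                k \<ge> 1 \<and> 1 \<le> p \<and> p \<le> 2 \<and> L > 0 \<and> \<sigma> \<ge> 0 \<and> \<delta> \<ge> 0 \<and> R > 0}](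
          \<lambda>(k, p, L, \<sigma>, \<delta>, R).
            L * R\<^sup>2 / real k powr p + \<sigma> * R / sqrt (real k) + real k powr (p - 1) * \<delta>)"
  (is "?f \<in> \<Theta>[?F](?g)")
proof -
  have s2: "1 \<le> sqrt 2" "sqrt 2 \<le> 2" by (auto simp: real_le_lsqrt)
  then have c: "1 \<le> 4 * sqrt 2" "1 \<le> 16 * sqrt 2" "4 * sqrt 2 \<le> 48" "16 * sqrt 2 \<le> 48"
    by linarith+
  have le: "0 \<le> ?g t" "?g t \<le> ?f t" "?f t \<le> 48 * ?g t"
    if "t \<in> {(k::nat, p, L, \<sigma>, \<delta>, R).
      k \<ge> 1 \<and> 1 \<le> p \<and> p \<le> 2 \<and> L > 0 \<and> \<sigma> \<ge> 0 \<and> \<delta> \<ge> 0 \<and> R > 0}" for t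
  proof -
    obtain k p L \<sigma> \<delta> R where t: "t = (k, p, L, \<sigma>, \<delta>, R)" by (cases t) auto
    define u v r where "u = L * R\<^sup>2 / real k powr p" and "v = \<sigma> * R / sqrt (real k)"
      and "r = real k powr (p - 1) * \<delta>"
    have nn: "u \<ge> 0" "v \<ge> 0" "r \<ge> 0" using that by (auto simp: t u_def v_def r_def)
    have g: "?g t = u + v + r" and f: "?f t = (4 * sqrt 2) * u + (16 * sqrt 2) * v + 48 * r"
      by (simp_all add: t u_def v_def r_def)
    show "0 \<le> ?g t" using nn unfolding g by simp
    have "1 * u \<le> (4 * sqrt 2) * u" "1 * v \<le> (16 * sqrt 2) * v"
      by (rule mult_right_mono[OF c(1) nn(1)], rule mult_right_mono[OF c(2) nn(2)])
    then show "?g t \<le> ?f t" using nn unfolding f g by simp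
    have "(4 * sqrt 2) * u \<le> 48 * u" "(16 * sqrt 2) * v \<le> 48 * v"
      by (rule mult_right_mono[OF c(3) nn(1)], rule mult_right_mono[OF c(4) nn(2)])
    then show "?f t \<le> 48 * ?g t" unfolding f g distrib_left by linarith
  qed
  show ?thesis
  proof (rule bigthetaI)
    show "?f \<in> O[?F](?g)"
      by (rule landau_o.bigI[of 48]) (use le in \<open>force simp: eventually_principal\<close>)+
    show "?f \<in> \<Omega>[?F](?g)"
      by (rule landau_omega.bigI[of 1]) (use le in \<open>force simp: eventually_principal\<close>)+
  qed
qed

theorem theorem2p1:
  fixes Q :: "'e::real_normed_vector set"
    and f h d :: "'e \<Rightarrow> real"
    and grad_d :: "'e \<Rightarrow> 'e \<Rightarrow>\<^sub>L real"
    and f\<^sub>o :: "'e \<Rightarrow> real" and g\<^sub>o :: "'e \<Rightarrow> 'e \<Rightarrow>\<^sub>L real"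
    and S :: "'s measure" and \<mu> :: "'e \<Rightarrow> 's measure"
    and F :: "'e \<Rightarrow> 's \<Rightarrow> real" and G :: "'e \<Rightarrow> 's \<Rightarrow> 'e \<Rightarrow>\<^sub>L real"
    and M :: "'w measure" and \<xi> :: "nat \<Rightarrow> 'w \<Rightarrow> 's"
    and x y z xhat w :: "nat \<Rightarrow> 'w \<Rightarrow> 'e"
    and xstar x0 :: 'e
    and L \<delta> \<sigma> R p a b :: real
    and \<alpha> \<beta> B :: "nat \<Rightarrow> real"
  defines "\<phi> \<equiv> (\<lambda>u. f u + h u)"
  assumes "finite_dim TYPE('e)"
    and "closed Q" and "convex Q"
    and "convex_on Q f" and "convex_on Q h"
    and "is_arg_min \<phi> (\<lambda>u. u \<in> Q) xstar"
    and "L > 0" and "\<delta> \<ge> 0" and "\<sigma> \<ge> 0"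
    and "inexact_oracle Q f \<delta> L f\<^sub>o g\<^sub>o"
    and "stochastic_oracle Q S \<mu> \<sigma> f\<^sub>o g\<^sub>o F G"
    and "prox_function Q d grad_d x0"
    and "1 \<le> p" and "p \<le> 2"
    and "a = 2 powr ((2 * p - 1) / 2)"
    and "b = 2 powr ((5 - 2 * p) / 4) * p powr ((1 - 2 * p) / 2)"
    and "R > 0" and "sqrt (2 * d xstar) \<le> R"
    and "\<And>i. \<alpha> i = 1 / a * ((real i + p) / p) powr (p - 1)"
    and "\<And>i. \<beta> i = L + b * \<sigma> / R * (real i + p + 1) powr ((2 * p - 1) / 2)"
    and "\<And>i. B i = a * (\<alpha> i)\<^sup>2"
    and "prob_space M"
    and "fresh_draws M S \<mu> x \<xi>"
    and "\<And>\<omega>. \<omega> \<in> space M \<Longrightarrow>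
           SIGM Q h d grad_d \<alpha> \<beta> B (\<lambda>i. G (x i \<omega>) (\<xi> i \<omega>))
             (\<lambda>i. x i \<omega>) (\<lambda>i. y i \<omega>) (\<lambda>i. z i \<omega>) (\<lambda>i. xhat i \<omega>) (\<lambda>i. w i \<omega>)"
    and "\<And>k. (\<lambda>\<omega>. \<phi> (y k \<omega>)) \<in> borel_measurable M"
  shows
    "(\<forall>k\<ge>1.
       integrable M (\<lambda>\<omega>. \<phi> (y k \<omega>)) \<and>
       (\<integral>\<omega>. \<phi> (y k \<omega>) \<partial>M) - \<phi> xstar
         \<le> L * R\<^sup>2 * p powr p * 2 powr ((2 * p - 3) / 2) / (real k + p) powr p
           + \<sigma> * R * 2 powr ((3 + 2 * p) / 4) * sqrt p * (real k + p + 2) powr (p - 1 / 2)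
               / (real k + p) powr p
           + 2 powr (2 * p - 1) * (((real k + p) / p) powr (p - 1) + 1) * \<delta> \<and>
       L * R\<^sup>2 * p powr p * 2 powr ((2 * p - 3) / 2) / (real k + p) powr p
         + \<sigma> * R * 2 powr ((3 + 2 * p) / 4) * sqrt p * (real k + p + 2) powr (p - 1 / 2)
             / (real k + p) powr p
         + 2 powr (2 * p - 1) * (((real k + p) / p) powr (p - 1) + 1) * \<delta>
         \<le> (4 * sqrt 2) * L * R\<^sup>2 / real k powr p + (16 * sqrt 2) * \<sigma> * R / sqrt (real k)
           + 48 * real k powr (p - 1) * \<delta>) \<and>
     (\<lambda>(k, p, L, \<sigma>, \<delta>, R).
        (4 * sqrt 2) * L * R\<^sup>2 / real k powr p + (16 * sqrt 2) * \<sigma> * R / sqrt (real k)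
          + 48 * real k powr (p - 1) * \<delta>)
       \<in> \<Theta>[principal {(k::nat, p, L, \<sigma>, \<delta>, R).
                k \<ge> 1 \<and> 1 \<le> p \<and> p \<le> 2 \<and> L > 0 \<and> \<sigma> \<ge> 0 \<and> \<delta> \<ge> 0 \<and> R > 0}](
          \<lambda>(k, p, L, \<sigma>, \<delta>, R).
            L * R\<^sup>2 / real k powr p + \<sigma> * R / sqrt (real k) + real k powr (p - 1) * \<delta>)"
proof -
  interpret par: sigm_parameters p L \<sigma> R a b \<alpha> \<beta> B
    by unfold_locales (fact assms)+
  interpret M: prob_space M by fact
  interpret run: stochastic_sigm M Q d grad_d x0 f h f\<^sub>o g\<^sub>o L \<delta> \<sigma> \<alpha> \<beta> B S \<mu> F G \<xi> x y z xhat w xstar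
    by unfold_locales (fact assms(2-)[unfolded \<phi>_def] par.\<alpha>_pos par.\<alpha>_0 par.B_0 par.\<alpha>_le_B
      par.B_le_A par.\<beta>_ge par.\<beta>_mono par.step_cond par.\<beta>_eq_L)+
  have d: "0 \<le> d xstar" by (rule run.d_nonneg[OF run.xs_mem])
  \<comment> \<open>Squaring the hypothesis on \<open>R\<close> yields the form in which
    \<open>rate\<close> uses it; nonnegativity of \<open>d xstar\<close> makes the square undo the
    root.\<close>
  have "2 * d xstar = (sqrt (2 * d xstar))\<^sup>2" using d by simp
  also have "\<dots> \<le> R\<^sup>2" by (rule power_mono) (use assms d in auto)
  finally have dR: "2 * d xstar \<le> R\<^sup>2" .
  note [simp] = \<open>1 \<le> p\<close> \<open>p \<le> 2\<close> \<open>L > 0\<close> \<open>\<sigma> \<ge> 0\<close> \<open>\<delta> \<ge> 0\<close> \<open>R > 0\<close>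
  show ?thesis
    using run.expected_gap par.rate[OF d dR \<open>\<delta> \<ge> 0\<close>, of k for k]
    by (intro conjI allI impI bigtheta_rate simplified_rate) (simp_all add: \<phi>_def less_imp_le)
qed

end
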